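(* Let $P,Q\in\mathbb Z$, $Q\ne0$, $f(t)=t^2-Pt+Q$ with roots $\theta_1,\theta_2$, $D=P^2-4Q\ne0$, $p$ a prime with $p\nmid Q$, and $r(p)$ the rank of the Lucas sequence. Let $G(f,p)\le K(f,p)\le G_{\mathbb Q}(f)$ and $G^*(f,p)\le K^*(f,p)\le G^*_{\mathbb Q}(f)$ be as in the context. (1) If $f\bmod p$ is irreducible over $\mathbb F_p$, then $K(f,p)/G(f,p)\simeq\mathbb F_p(\theta_1)^\times/\mathbb F_p^\times\simeq\mathbb Z/(p+1)\mathbb Z$ via $[w_1:w_0]\mapsto w_1-w_0\theta_1\bmod\mathbb F_p^\times$, and $K^*(f,p)/G^*(f,p)\simeq\mathbb F_p(\theta_1)^\times/\mathbb F_p^\times\langle\theta_1\rangle\simeq\mathbb Z/((p+1)/r(p))\mathbb Z$ via $[w_1:w_0]\mapsto w_1-w_0\theta_1\bmod\mathbb F_p^\times\langle\theta_1\rangle$. (2) Suppose $f\bmod p$ is reducible over $\mathbb F_p$. If $p\nmid D$, then $K(f,p)/G(f,p)\simeq\mathbb F_p^\times\simeq\mathbb Z/(p-1)\mathbb Z$ via $[w_1:w_0]\mapsto(w_1-w_0\theta_1)(w_1-w_0\theta_2)^{-1}$, and $K^*(f,p)/G^*(f,p)\simeq\mathbb F_p^\times/\langle\theta_1\theta_2^{-1}\rangle\simeq\mathbb Z/((p-1)/r(p))\mathbb Z$ via the same map modulo $\langle\theta_1\theta_2^{-1}\rangle$. If $p\mid D$, then $K(f,p)/G(f,p)\simeq\mathbb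 F_p$ via $[w_1:w_0]\mapsto -w_0(w_1-w_0\theta)^{-1}$, where $\theta$ is the double root of $f\bmod p$, and $K^*(f,p)/G^*(f,p)$ is trivial.
   Context: $\mathscr S(f,R)^{\times}$ (for $R=\mathbb Q$ or $\mathbb F_p$) is the set of sequences $(w_n)_{n\in\mathbb Z}$ in $R$ with $w_{n+2}-Pw_{n+1}+Qw_n=0$ and $\Lambda(w_1,w_0):=w_1^2-Pw_0w_1+Qw_0^2\in R^\times$, a group under $(w_n)*(v_n)=(u_n)$, $u_1=w_1v_1-Qw_0v_0$, $u_0=w_0v_1+w_1v_0-Pw_0v_0$. $G_R(f)$ is its quotient by ${\bf w}\sim{\bf v}\iff w_n=\lambda v_n$ for all $n$ ($\lambda\in R^\times$), and $G^*_R(f)$ its quotient by $w_n=\lambda v_{n+\nu}$ for all $n$ ($\lambda\in R^\times$, $\nu\in\mathbb Z$); $[w_1:w_0]$ denotes the class with initial terms $w_1,w_0$, and $\pi:G_{\mathbb Q}(f)\to G^*_{\mathbb Q}(f)$ the natural map. $\mathrm{red}_p:G_{\mathbb Q}(f)\to\mathbb P^1(\mathbb F_p)$ sends $[w_1:w_0]$ (with $w_0,w_1\in\mathbb Z$ coprime) to its reduction mod $p$; $G_{\mathbb F_p}(f)\subset\mathbb P^1(\mathbb F_p)$. $G(f,p)=\mathrm{red}_p^{-1}([1:0])$, $K(f,p)=\mathrm{red}_p^{-1}(G_{\mathbb F_p}(f))$, $G^*(f,p)=\pi(G(f,p))$, $K^*(f,p)=\pi(K(f,p))$. The Lucas sequence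 $\mathcal F$ has $\mathcal F_0=0,\mathcal F_1=1$ and the recurrence; its rank $r(p)$ is the least positive $n$ with $\mathcal F_n\in p\mathbb Z_{(p)}$. *)

theory Defs
  imports
    "HOL-Algebra.Algebraic_Closure_Type"
    "HOL-Algebra.Elementary_Groups"
    "HOL-Algebra.Multiplicative_Group"
    "HOL-Algebra.Generated_Fields"
    "Berlekamp_Zassenhaus.Finite_Field"
begin

text \<open>Throughout, the coefficient ring \<open>R\<close> is a type of class \<^class>\<open>field\<close>, so that
  \<open>R\<^sup>\<times>\<close> consists of the nonzero elements: \<^typ>\<open>rat\<close> for the rational numbers and
  \<open>'p mod_ring\<close> with \<open>'p :: prime_card\<close> for the field with \<open>p = CARD('p)\<close> elements.\<close>

definition char_poly2 :: "int \<Rightarrow> int \<Rightarrow> 'a::field poly" where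
  "char_poly2 P Q = [:of_int Q, - of_int P, 1:]"

definition rec_seqs :: "int \<Rightarrow> int \<Rightarrow> (int \<Rightarrow> 'a::field) set" where
  "rec_seqs P Q = {w. \<forall>n. w (n + 2) - of_int P * w (n + 1) + of_int Q * w n = 0}"

definition Lam :: "int \<Rightarrow> int \<Rightarrow> 'a::field \<Rightarrow> 'a \<Rightarrow> 'a" where
  "Lam P Q a b = a ^ 2 - of_int P * b * a + of_int Q * b ^ 2"

definition unit_seqs :: "int \<Rightarrow> int \<Rightarrow> (int \<Rightarrow> 'a::field) set" where
  "unit_seqs P Q = {w \<in> rec_seqs P Q. Lam P Q (w 1) (w 0) \<noteq> 0}"

text \<open>The description below is unique as soon as \<open>Q\<close> is invertible in \<open>R\<close>.\<close>

definition seq_of :: "int \<Rightarrow> int \<Rightarrow> 'a::field \<Rightarrow> 'a \<Rightarrow> int \<Rightarrow> 'a" where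
  "seq_of P Q a b = (THE w. w \<in> rec_seqs P Q \<and> w 1 = a \<and> w 0 = b)"

definition lucas :: "int \<Rightarrow> int \<Rightarrow> int \<Rightarrow> 'a::field" where
  "lucas P Q = seq_of P Q 1 0"

definition seq_mult :: "int \<Rightarrow> int \<Rightarrow> (int \<Rightarrow> 'a::field) \<Rightarrow> (int \<Rightarrow> 'a) \<Rightarrow> int \<Rightarrow> 'a" where
  "seq_mult P Q w v =
     seq_of P Q (w 1 * v 1 - of_int Q * w 0 * v 0) (w 0 * v 1 + w 1 * v 0 - of_int P * w 0 * v 0)"

definition scale_rel :: "int \<Rightarrow> int \<Rightarrow> ((int \<Rightarrow> 'a::field) \<times> (int \<Rightarrow> 'a)) set" where
  "scale_rel P Q = {(w, v). w \<in> unit_seqs P Q \<and> v \<in> unit_seqs P Q \<and>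
     (\<exists>c. c \<noteq> 0 \<and> (\<forall>n. w n = c * v n))}"

definition shift_rel :: "int \<Rightarrow> int \<Rightarrow> ((int \<Rightarrow> 'a::field) \<times> (int \<Rightarrow> 'a)) set" where
  "shift_rel P Q = {(w, v). w \<in> unit_seqs P Q \<and> v \<in> unit_seqs P Q \<and>
     (\<exists>c k. c \<noteq> 0 \<and> (\<forall>n. w n = c * v (n + k)))}"

definition seq_quot ::
  "int \<Rightarrow> int \<Rightarrow> ((int \<Rightarrow> 'a::field) \<times> (int \<Rightarrow> 'a)) set \<Rightarrow> (int \<Rightarrow> 'a) set monoid" where
  "seq_quot P Q r =
     \<lparr>carrier = unit_seqs P Q // r,
      monoid.mult = (\<lambda>A B. \<Union>w\<in>A. \<Union>v\<in>B. r `` {seq_mult P Q w v}),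
      one = r `` {lucas P Q}\<rparr>"

definition G_grp :: "int \<Rightarrow> int \<Rightarrow> (int \<Rightarrow> 'a::field) set monoid" where
  "G_grp P Q = seq_quot P Q (scale_rel P Q)"

definition Gstar_grp :: "int \<Rightarrow> int \<Rightarrow> (int \<Rightarrow> 'a::field) set monoid" where
  "Gstar_grp P Q = seq_quot P Q (shift_rel P Q)"

text \<open>The class \<open>[a : b]\<close>, where \<open>a\<close> is the term of index 1 and \<open>b\<close> the term of index 0.
  It is empty, hence not in the carrier of \<open>G_grp P Q\<close>, if \<open>Lam P Q a b = 0\<close>.\<close>

definition cls :: "int \<Rightarrow> int \<Rightarrow> 'a::field \<Rightarrow> 'a \<Rightarrow> (int \<Rightarrow> 'a) set" where
  "cls P Q a b = scale_rel P Q `` {seq_of P Q a b}"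

definition to_star :: "int \<Rightarrow> int \<Rightarrow> (int \<Rightarrow> 'a::field) set \<Rightarrow> (int \<Rightarrow> 'a) set" where
  "to_star P Q A = shift_rel P Q `` A"

text \<open>A point \<open>[a : b]\<close> of the projective line is the punctured line through \<open>(a, b)\<close>; the
  inclusion of \<open>G_grp P Q\<close> into the projective line sends a class of sequences to the
  set of its pairs of initial terms.\<close>

definition proj_pt :: "'a::field \<Rightarrow> 'a \<Rightarrow> ('a \<times> 'a) set" where
  "proj_pt a b = {(c * a, c * b) | c. c \<noteq> 0}"

definition cls_to_proj :: "(int \<Rightarrow> 'a::field) set \<Rightarrow> ('a \<times> 'a) set" where
  "cls_to_proj A = (\<lambda>w. (w 1, w 0)) ` A"

definition red :: "int \<Rightarrow> int \<Rightarrow> (int \<Rightarrow> rat) set \<Rightarrow> ('p::prime_card mod_ring \<times> 'p mod_ring) set" where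
  "red P Q A = (THE x. \<exists>a b :: int. coprime a b \<and> A = cls P Q (of_int a) (of_int b) \<and>
     x = proj_pt (of_int a) (of_int b))"

definition G_sub :: "int \<Rightarrow> int \<Rightarrow> 'p::prime_card itself \<Rightarrow> (int \<Rightarrow> rat) set set" where
  "G_sub P Q _ =
     {A \<in> carrier (G_grp P Q). red P Q A = (proj_pt 1 0 :: ('p mod_ring \<times> 'p mod_ring) set)}"

definition K_sub :: "int \<Rightarrow> int \<Rightarrow> 'p::prime_card itself \<Rightarrow> (int \<Rightarrow> rat) set set" where
  "K_sub P Q _ =
     {A \<in> carrier (G_grp P Q). red P Q A \<in>
        cls_to_proj ` carrier (G_grp P Q :: (int \<Rightarrow> 'p mod_ring) set monoid)}"

definition Gstar_sub :: "int \<Rightarrow> int \<Rightarrow> 'p::prime_card itself \<Rightarrow> (int \<Rightarrow> rat) set set" where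
  "Gstar_sub P Q p = to_star P Q ` G_sub P Q p"

definition Kstar_sub :: "int \<Rightarrow> int \<Rightarrow> 'p::prime_card itself \<Rightarrow> (int \<Rightarrow> rat) set set" where
  "Kstar_sub P Q p = to_star P Q ` K_sub P Q p"

definition K_grp :: "int \<Rightarrow> int \<Rightarrow> 'p::prime_card itself \<Rightarrow> (int \<Rightarrow> rat) set monoid" where
  "K_grp P Q p = (G_grp P Q)\<lparr>carrier := K_sub P Q p\<rparr>"

definition Kstar_grp :: "int \<Rightarrow> int \<Rightarrow> 'p::prime_card itself \<Rightarrow> (int \<Rightarrow> rat) set monoid" where
  "Kstar_grp P Q p = (Gstar_grp P Q)\<lparr>carrier := Kstar_sub P Q p\<rparr>"

text \<open>Membership of a rational number in \<open>p\<int>\<^sub>(\<^sub>p\<^sub>)\<close>.\<close>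

definition in_pZp :: "nat \<Rightarrow> rat \<Rightarrow> bool" where
  "in_pZp p x \<longleftrightarrow> (\<exists>a b :: int. \<not> int p dvd b \<and> x = of_nat p * (of_int a / of_int b))"

definition lucas_rank :: "int \<Rightarrow> int \<Rightarrow> nat \<Rightarrow> nat" where
  "lucas_rank P Q p = (LEAST n. n > 0 \<and> in_pZp p (lucas P Q (int n)))"

text \<open>A base field and its simple extensions, as subfields of the algebraic closure.\<close>

definition base_field :: "'a::field alg_closure ring" where
  "base_field = ring_of_type_algebra\<lparr>carrier := range to_ac\<rparr>"

definition adjoin :: "'a::field alg_closure \<Rightarrow> 'a alg_closure ring" where
  "adjoin \<theta> = ring_of_type_algebra
     \<lparr>carrier := generate_field ring_of_type_algebra (insert \<theta> (range to_ac))\<rparr>"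

abbreviation mult_group :: "'a ring \<Rightarrow> 'a monoid" where
  "mult_group \<equiv> Multiplicative_Group.mult_of"

text \<open>The quotient \<open>A Mod N\<close> is isomorphic to \<open>B\<close> via the map induced by
  \<open>rep w\<^sub>1 w\<^sub>0 \<mapsto> g w\<^sub>1 w\<^sub>0\<close>, for coprime integers \<open>w\<^sub>1, w\<^sub>0\<close>.\<close>

definition quot_iso_via ::
  "'a monoid \<Rightarrow> 'a set \<Rightarrow> (int \<Rightarrow> int \<Rightarrow> 'a) \<Rightarrow> 'b monoid \<Rightarrow> (int \<Rightarrow> int \<Rightarrow> 'b) \<Rightarrow> bool" where
  "quot_iso_via A N rep B g \<longleftrightarrow>
     (\<exists>\<phi> \<in> iso (A Mod N) B. \<forall>w1 w0. coprime w1 w0 \<longrightarrow> rep w1 w0 \<in> carrier A \<longrightarrow>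
        \<phi> (N #>\<^bsub>A\<^esub> rep w1 w0) = g w1 w0)"

definition K_iso_via :: "int \<Rightarrow> int \<Rightarrow> 'p::prime_card itself \<Rightarrow> 'b monoid \<Rightarrow> (int \<Rightarrow> int \<Rightarrow> 'b) \<Rightarrow> bool"
  where "K_iso_via P Q p = quot_iso_via (K_grp P Q p) (G_sub P Q p)
     (\<lambda>w1 w0. cls P Q (of_int w1) (of_int w0))"

definition Kstar_iso_via :: "int \<Rightarrow> int \<Rightarrow> 'p::prime_card itself \<Rightarrow> 'b monoid \<Rightarrow> (int \<Rightarrow> int \<Rightarrow> 'b) \<Rightarrow> bool"
  where "Kstar_iso_via P Q p = quot_iso_via (Kstar_grp P Q p) (Gstar_sub P Q p)
     (\<lambda>w1 w0. to_star P Q (cls P Q (of_int w1) (of_int w0)))"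

end

theory Submission
  imports Defs
begin

text \<open>
  A sequence with initial terms \<open>w\<^sub>1, w\<^sub>0\<close> corresponds to the element \<open>w\<^sub>1 - w\<^sub>0 \<theta>\<close> of the algebra
  \<open>R[t]/(f)\<close>; the product of sequences is the product of that algebra, and the shift is
  multiplication by the conjugate root. Hence \<open>K(f,p)\<close> consists of the classes of integer pairs whose
  norm \<open>w\<^sub>1\<^sup>2 - P w\<^sub>0 w\<^sub>1 + Q w\<^sub>0\<^sup>2\<close> is prime to \<open>p\<close>, \<open>G(f,p)\<close> of those with moreover \<open>p\<close> dividing \<open>w\<^sub>0\<close>,
  and any multiplicative surjective function \<open>g\<close> of such pairs that is trivial precisely when
  \<open>p\<close> divides \<open>w\<^sub>0\<close> induces an isomorphism on \<open>K(f,p)/G(f,p)\<close>. On the starred quotient the kernel has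
  to be enlarged by the image of the shift \<open>(P, 1)\<close>, whose order is the rank \<open>r(p)\<close> because its powers
  are the pairs of consecutive Lucas numbers.
\<close>

section \<open>Recurrence sequences over a field\<close>

text \<open>The statement speaks of coprime pairs, but these are stable neither under the product
  nor under the shift, whereas pairs of norm prime to \<open>p\<close> are stable under both. The
  groups are therefore parametrised by the latter; a common factor of such a pair is itself prime to
  \<open>p\<close> and can be divided out, and coprimality returns only when the explicit formulas
  are read off. The shift multiplies by the conjugate root, while the statement divides by the
  powers of \<open>\<theta>\<^sub>1\<close> or of
  \<open>\<theta>\<^sub>1 * inverse \<theta>\<^sub>2\<close>. The subgroups agree because
  \<open>\<theta>\<^sub>1 * \<theta>\<^sub>2 = Q\<close> is a scalar and because a subgroup contains
  inverses. All target groups are placed inside one algebraic closure of the prime field, so that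
  the prime field and its quadratic extension are subsets of a single type. Their orders then come
  from the cyclicity of finite unit groups and from a count of the enlarged kernel, which is where
  the rank enters. For a double root the explicit map is a logarithmic derivative: the shift becomes
  a translation by a nonzero constant, which already generates the additive group of the prime
  field.\<close>

locale lucas_field =
  fixes P Q :: int and ty :: "'a::field itself"
  assumes Q_nz: "of_int Q \<noteq> (0::'a)"
begin

text \<open>Two consecutive values travel together through an induction in both directions; going
  down, the recurrence is solved for the earlier term, which is where \<open>of_int Q\<close> has to
  be invertible.\<close>

lemma rec_seqs_eqI:
  fixes w v :: "int \<Rightarrow> 'a"
  assumes w: "w \<in> rec_seqs P Q" and v: "v \<in> rec_seqs P Q" and "w 1 = v 1" "w 0 = v 0"
  shows "w = v"
proof -
  have rw: "w (n + 2) = of_int P * w (n + 1) - of_int Q * w n" for n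
    using w by (simp add: rec_seqs_def algebra_simps)
  have rv: "v (n + 2) = of_int P * v (n + 1) - of_int Q * v n" for n
    using v by (simp add: rec_seqs_def algebra_simps)
  have "w n = v n \<and> w (n + 1) = v (n + 1)" for n
  proof (induction n rule: int_induct[where k = 0])
    case base
    then show ?case using assms by simp
  next
    case (step1 i)
    then show ?case using rw[of i] rv[of i] by (simp add: add.assoc)
  next
    case (step2 i)
    have "i - 1 + 2 = 1 + i" "i - 1 + 1 = i" by simp_all
    then have "of_int Q * w (i - 1) = of_int P * w i - w (1 + i)"
      "of_int Q * v (i - 1) = of_int P * v i - v (1 + i)"
      using rw[of "i - 1"] rv[of "i - 1"] by simp_all
    then have "of_int Q * w (i - 1) = of_int Q * v (i - 1)" using step2 by (simp add: add.commute)
    then show ?case using step2 Q_nz by simp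
  qed
  then show ?thesis by blast
qed

lemma rec_seqs_ex:
  fixes a b :: 'a
  shows "\<exists>w \<in> rec_seqs P Q. w 1 = a \<and> w 0 = b"
proof -
  define T :: "'a \<times> 'a \<Rightarrow> 'a \<times> 'a" where
    "T = (\<lambda>(x, y). (of_int P * x - of_int Q * y, x))"
  define T' :: "'a \<times> 'a \<Rightarrow> 'a \<times> 'a" where
    "T' = (\<lambda>(x, y). (y, (of_int P * y - x) / of_int Q))"
  \<comment> \<open>The state at \<open>n\<close> holds the terms of index \<open>n + 1\<close> and
    \<open>n\<close>. \<open>T'\<close> acts only on the negative side, so the step law there
    reduces to \<open>T (T' x) = x\<close>.\<close>
  define st where "st n = (if n \<ge> 0 then (T ^^ nat n) (a, b) else (T' ^^ nat (- n)) (a, b))" for n :: int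
  have TT': "T (T' x) = x" for x
    using Q_nz by (cases x) (simp add: T_def T'_def)
  have step: "st (n + 1) = T (st n)" for n
  proof (cases "n \<ge> 0")
    case True
    then have "nat (n + 1) = Suc (nat n)" by simp
    with True show ?thesis by (simp add: st_def)
  next
    case False
    define m where "m = nat (- n - 1)"
    have n: "n = - int m - 1" using False by (simp add: m_def)
    show ?thesis
    proof (cases "m = 0")
      case True
      then show ?thesis using n TT'[of "(a, b)"] by (simp add: st_def)
    next
      case False
      have "nat (- n) = Suc m" "nat (- (n + 1)) = m" using n by auto
      then show ?thesis using n False TT' by (simp add: st_def)
    qed
  qed
  define w where "w n = snd (st n)" for n
  have w1: "w (n + 1) = fst (st n)" for n
    by (simp add: w_def step T_def split: prod.splits)
  have "w (n + 2) = of_int P * w (n + 1) - of_int Q * w n" for n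
  proof -
    have "w (n + 2) = fst (st (n + 1))" using w1[of "n + 1"] by (simp add: add.assoc)
    also have "\<dots> = of_int P * fst (st n) - of_int Q * snd (st n)"
      by (simp add: step T_def split: prod.splits)
    finally show ?thesis by (simp only: w1) (simp add: w_def)
  qed
  then have "w \<in> rec_seqs P Q" by (simp add: rec_seqs_def)
  moreover have "w 0 = b" by (simp add: w_def st_def)
  moreover have "w 1 = a" using w1[of 0] by (simp add: st_def)
  ultimately show ?thesis by blast
qed

lemma seq_of_props:
  fixes a b :: 'a
  shows seq_of_rec: "seq_of P Q a b \<in> rec_seqs P Q"
    and seq_of_1 [simp]: "seq_of P Q a b 1 = a"
    and seq_of_0 [simp]: "seq_of P Q a b 0 = b"
proof -
  have "\<exists>!w. w \<in> rec_seqs P Q \<and> w 1 = a \<and> w 0 = b"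
    using rec_seqs_ex[of a b] rec_seqs_eqI by (metis (no_types, lifting))
  from theI'[OF this, folded seq_of_def]
  show "seq_of P Q a b \<in> rec_seqs P Q" "seq_of P Q a b 1 = a" "seq_of P Q a b 0 = b"
    by auto
qed

lemma seq_of_eqI:
  fixes w :: "int \<Rightarrow> 'a"
  assumes "w \<in> rec_seqs P Q" "w 1 = a" "w 0 = b"
  shows "seq_of P Q a b = w"
  using assms by (intro rec_seqs_eqI) (auto intro: seq_of_rec)

lemma seq_of_unit_iff:
  fixes a b :: 'a
  shows "seq_of P Q a b \<in> unit_seqs P Q \<longleftrightarrow> Lam P Q a b \<noteq> 0"
  by (simp add: unit_seqs_def seq_of_rec)

lemma rec_step:
  fixes w :: "int \<Rightarrow> 'a"
  assumes "w \<in> rec_seqs P Q"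
  shows "w (n + 1) = of_int P * w n - of_int Q * w (n - 1)"
proof -
  have "w (n - 1 + 2) - of_int P * w (n - 1 + 1) + of_int Q * w (n - 1) = 0"
    using assms unfolding rec_seqs_def by blast
  then show ?thesis by (simp add: algebra_simps eq_neg_iff_add_eq_0)
qed

lemma shift_rec:
  fixes w :: "int \<Rightarrow> 'a"
  assumes "w \<in> rec_seqs P Q"
  shows "(\<lambda>n. w (n + k)) \<in> rec_seqs P Q"
proof -
  have "w (n + 2 + k) - of_int P * w (n + 1 + k) + of_int Q * w (n + k) = 0" for n
    using assms[unfolded rec_seqs_def] by (auto dest: spec[of _ "n + k"] simp: algebra_simps)
  then show ?thesis by (simp add: rec_seqs_def)
qed

text \<open>In this form the product visibly commutes with scalars and shifts of the first factor.\<close>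

lemma seq_mult_eq:
  fixes w v :: "int \<Rightarrow> 'a"
  assumes w: "w \<in> rec_seqs P Q"
  shows "seq_mult P Q w v = (\<lambda>n. v 1 * w n - of_int Q * v 0 * w (n - 1))"
  unfolding seq_mult_def
proof (rule seq_of_eqI)
  show "(\<lambda>n. v 1 * w n - of_int Q * v 0 * w (n - 1)) \<in> rec_seqs P Q"
    unfolding rec_seqs_def
  proof (intro CollectI allI)
    fix n
    have *: "w (n + 2) = of_int P * w (n + 1) - of_int Q * w n"
        "w (n + 1) = of_int P * w n - of_int Q * w (n - 1)"
      using rec_step[OF w, of "n + 1"] rec_step[OF w, of n] by (simp_all add: add.assoc)
    have "v 1 * w (n + 2) - of_int Q * v 0 * w (n + 2 - 1) -
      of_int P * (v 1 * w (n + 1) - of_int Q * v 0 * w (n + 1 - 1)) +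
      of_int Q * (v 1 * w n - of_int Q * v 0 * w (n - 1)) =
      v 1 * w (n + 2) - of_int Q * v 0 * w (n + 1) -
      of_int P * (v 1 * w (n + 1) - of_int Q * v 0 * w n) +
      of_int Q * (v 1 * w n - of_int Q * v 0 * w (n - 1))" by (simp add: algebra_simps)
    also have "\<dots> = 0" unfolding * by (simp add: algebra_simps)
    finally show "v 1 * w (n + 2) - of_int Q * v 0 * w (n + 2 - 1) -
      of_int P * (v 1 * w (n + 1) - of_int Q * v 0 * w (n + 1 - 1)) +
      of_int Q * (v 1 * w n - of_int Q * v 0 * w (n - 1)) = 0" .
  qed
  show "v 1 * w 1 - of_int Q * v 0 * w (1 - 1) = w 1 * v 1 - of_int Q * w 0 * v 0"
    by simp
  show "v 1 * w 0 - of_int Q * v 0 * w (0 - 1) = w 0 * v 1 + w 1 * v 0 - of_int P * w 0 * v 0"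
  proof -
    \<comment> \<open>The term of index -1 enters at index 0; the recurrence trades it for the two
      initial terms.\<close>
    have "of_int P * w 0 = w 1 + of_int Q * w (- 1)"
      using rec_step[OF w, of 0] by (simp add: algebra_simps)
    then have "w 0 * v 1 + w 1 * v 0 - (of_int P * w 0) * v 0 = v 1 * w 0 - of_int Q * v 0 * w (- 1)"
      by (simp add: algebra_simps)
    then show ?thesis by simp
  qed
qed

section \<open>Multiplication of sequences and the two quotient groups\<close>

lemma seq_mult_comm: "seq_mult P Q w v = seq_mult P Q v (w :: int \<Rightarrow> 'a)"
  by (simp add: seq_mult_def mult.commute mult.left_commute add.commute)

text \<open>\<open>Lam P Q a b\<close> is the norm of \<open>a - b * \<theta>\<close>, so its
  multiplicativity holds as a polynomial identity.\<close>

lemma Lam_mult: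
  fixes a b c d :: 'a
  shows "Lam P Q (a * c - of_int Q * b * d) (b * c + a * d - of_int P * b * d) = Lam P Q a b * Lam P Q c d"
  by (simp add: Lam_def power2_eq_square algebra_simps)

lemma seq_mult_1: "seq_mult P Q w v 1 = w 1 * v 1 - of_int Q * w 0 * (v 0 :: 'a)"
  and seq_mult_0: "seq_mult P Q w v 0 = w 0 * v 1 + w 1 * v 0 - of_int P * w 0 * (v 0 :: 'a)"
  by (simp_all add: seq_mult_def)

lemma seq_mult_rec: "seq_mult P Q w (v :: int \<Rightarrow> 'a) \<in> rec_seqs P Q"
  by (simp add: seq_mult_def seq_of_rec)

lemma seq_mult_unit:
  fixes w v :: "int \<Rightarrow> 'a"
  assumes "w \<in> unit_seqs P Q" "v \<in> unit_seqs P Q"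
  shows "seq_mult P Q w v \<in> unit_seqs P Q"
  using assms Lam_mult[of "w 1" "v 1" "w 0" "v 0"]
  by (simp add: unit_seqs_def seq_mult_rec seq_mult_1 seq_mult_0)

lemma lucas_unit: "lucas P Q \<in> (unit_seqs P Q :: (int \<Rightarrow> 'a) set)"
  by (simp add: lucas_def seq_of_unit_iff Lam_def)

text \<open>Kept general in \<open>r\<close> because scaling and shifting share the argument.
  Compatibility is asked for in the first factor only; commutativity of the product transports it to
  the second.\<close>

lemma seq_quot_group:
  fixes r :: "((int \<Rightarrow> 'a) \<times> (int \<Rightarrow> 'a)) set"
  assumes r: "equiv (unit_seqs P Q) r"
    and compat: "\<And>w w' v. (w, w') \<in> r \<Longrightarrow> v \<in> unit_seqs P Q \<Longrightarrow> (seq_mult P Q w v, seq_mult P Q w' v) \<in> r"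
  shows seq_quot_mult: "\<And>w v. w \<in> unit_seqs P Q \<Longrightarrow> v \<in> unit_seqs P Q \<Longrightarrow>
      r `` {w} \<otimes>\<^bsub>seq_quot P Q r\<^esub> r `` {v} = r `` {seq_mult P Q w v}"
    and seq_quot_comm_group: "comm_group (seq_quot P Q r)"
proof -
  have sub: "w \<in> unit_seqs P Q" "v \<in> unit_seqs P Q" if "(w, v) \<in> r" for w v
    using that r by (auto simp: equiv_def refl_on_def)
  have mult: "r `` {w} \<otimes>\<^bsub>seq_quot P Q r\<^esub> r `` {v} = r `` {seq_mult P Q w v}"
    if w: "w \<in> unit_seqs P Q" and v: "v \<in> unit_seqs P Q" for w v
  proof -
    have class_eq: "r `` {seq_mult P Q w' v'} = r `` {seq_mult P Q w v}"
      if "w' \<in> r `` {w}" "v' \<in> r `` {v}" for w' v'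
    proof -
      have "(seq_mult P Q w v, seq_mult P Q w' v) \<in> r" using that v compat by blast
      moreover have "(seq_mult P Q v w', seq_mult P Q v' w') \<in> r" using that sub compat by blast
      ultimately have "(seq_mult P Q w v, seq_mult P Q w' v') \<in> r"
        using r by (metis seq_mult_comm equivE transE)
      then show ?thesis using equiv_class_eq[OF r] by blast
    qed
    have "w \<in> r `` {w}" "v \<in> r `` {v}" using w v equiv_class_self[OF r] by blast+
    have "r `` {w} \<otimes>\<^bsub>seq_quot P Q r\<^esub> r `` {v} =
        (\<Union>w'\<in>r `` {w}. \<Union>v'\<in>r `` {v}. r `` {seq_mult P Q w' v'})"
      by (simp add: seq_quot_def)
    also have "\<dots> = (\<Union>w'\<in>r `` {w}. \<Union>v'\<in>r `` {v}. r `` {seq_mult P Q w v})"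
      by (intro SUP_cong refl class_eq)
    finally show ?thesis using \<open>w \<in> r `` {w}\<close> \<open>v \<in> r `` {v}\<close> by auto
  qed
  then show "\<And>w v. w \<in> unit_seqs P Q \<Longrightarrow> v \<in> unit_seqs P Q \<Longrightarrow>
      r `` {w} \<otimes>\<^bsub>seq_quot P Q r\<^esub> r `` {v} = r `` {seq_mult P Q w v}" .
  have car: "carrier (seq_quot P Q r) = {r `` {w} | w. w \<in> unit_seqs P Q}"
    by (auto simp: seq_quot_def quotient_def)
  have one: "\<one>\<^bsub>seq_quot P Q r\<^esub> = r `` {lucas P Q}" by (simp add: seq_quot_def)
  show "comm_group (seq_quot P Q r)"
  proof (rule comm_groupI)
    fix x y assume "x \<in> carrier (seq_quot P Q r)" "y \<in> carrier (seq_quot P Q r)"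
    then show "x \<otimes>\<^bsub>seq_quot P Q r\<^esub> y \<in> carrier (seq_quot P Q r)"
      using seq_mult_unit by (fastforce simp: car mult)
  next
    show "\<one>\<^bsub>seq_quot P Q r\<^esub> \<in> carrier (seq_quot P Q r)" by (auto simp: one car lucas_unit)
  next
    fix x y z assume "x \<in> carrier (seq_quot P Q r)" "y \<in> carrier (seq_quot P Q r)" "z \<in> carrier (seq_quot P Q r)"
    then obtain u v w where "u \<in> unit_seqs P Q" "v \<in> unit_seqs P Q" "w \<in> unit_seqs P Q"
      "x = r `` {u}" "y = r `` {v}" "z = r `` {w}" by (auto simp: car)
    moreover have "seq_mult P Q (seq_mult P Q u v) w = seq_mult P Q u (seq_mult P Q v w)"
      by (rule rec_seqs_eqI) (simp_all add: seq_mult_rec seq_mult_1 seq_mult_0 algebra_simps)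
    ultimately show "x \<otimes>\<^bsub>seq_quot P Q r\<^esub> y \<otimes>\<^bsub>seq_quot P Q r\<^esub> z = x \<otimes>\<^bsub>seq_quot P Q r\<^esub> (y \<otimes>\<^bsub>seq_quot P Q r\<^esub> z)"
      by (simp add: mult seq_mult_unit)
  next
    fix x y assume "x \<in> carrier (seq_quot P Q r)" "y \<in> carrier (seq_quot P Q r)"
    then show "x \<otimes>\<^bsub>seq_quot P Q r\<^esub> y = y \<otimes>\<^bsub>seq_quot P Q r\<^esub> x"
      by (auto simp: car mult) (metis seq_mult_comm)+
  next
    fix x assume "x \<in> carrier (seq_quot P Q r)"
    then obtain u where u: "u \<in> unit_seqs P Q" "x = r `` {u}" by (auto simp: car)
    have "seq_mult P Q (lucas P Q) u = u"
      using u by (intro rec_seqs_eqI)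
        (simp_all add: seq_mult_rec seq_mult_1 seq_mult_0 lucas_def unit_seqs_def)
    then show "\<one>\<^bsub>seq_quot P Q r\<^esub> \<otimes>\<^bsub>seq_quot P Q r\<^esub> x = x"
      using u by (simp add: one mult lucas_unit)
  next
    fix x assume "x \<in> carrier (seq_quot P Q r)"
    then obtain u where u: "u \<in> unit_seqs P Q" "x = r `` {u}" by (auto simp: car)
    define L where "L = Lam P Q (u 1) (u 0)"
    have L: "L \<noteq> 0" using u by (simp add: unit_seqs_def L_def)
    \<comment> \<open>The inverse is the conjugate divided by the norm: the conjugate of
      \<open>u 1 - u 0 * \<theta>\<close> has the pair
      \<open>(u 1 - P * u 0, - u 0)\<close>.\<close>
    define v where "v = seq_of P Q ((u 1 - of_int P * u 0) / L) (- u 0 / L)"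
    have vu: "seq_mult P Q v u = lucas P Q"
    proof (rule rec_seqs_eqI)
      have "seq_mult P Q v u 1 = ((u 1 - of_int P * u 0) * u 1 + of_int Q * u 0 * u 0) / L"
        by (simp add: seq_mult_1 v_def add_divide_distrib diff_divide_distrib algebra_simps)
      also have "(u 1 - of_int P * u 0) * u 1 + of_int Q * u 0 * u 0 = L"
        by (simp add: L_def Lam_def power2_eq_square algebra_simps)
      finally show "seq_mult P Q v u 1 = lucas P Q 1" using L by (simp add: lucas_def)
      have "seq_mult P Q v u 0 = (- u 0 * u 1 + (u 1 - of_int P * u 0) * u 0 + of_int P * u 0 * u 0) / L"
        by (simp add: seq_mult_0 v_def add_divide_distrib diff_divide_distrib algebra_simps)
      then show "seq_mult P Q v u 0 = lucas P Q 0" by (simp add: lucas_def algebra_simps)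
    qed (simp_all add: seq_mult_rec lucas_def seq_of_rec)
    \<comment> \<open>Multiplicativity of the norm shows that \<open>v\<close> is a unit sequence
      without expanding its definition.\<close>
    have "Lam P Q (v 1) (v 0) * L = Lam P Q (seq_mult P Q v u 1) (seq_mult P Q v u 0)"
      unfolding seq_mult_1 seq_mult_0 Lam_mult L_def ..
    also have "\<dots> = 1" unfolding vu by (simp add: lucas_def Lam_def)
    finally have "v \<in> unit_seqs P Q" by (auto simp: unit_seqs_def v_def seq_of_rec)
    then show "\<exists>y\<in>carrier (seq_quot P Q r). y \<otimes>\<^bsub>seq_quot P Q r\<^esub> x = \<one>\<^bsub>seq_quot P Q r\<^esub>"
      using u vu by (intro bexI[of _ "r `` {v}"]) (auto simp: one car mult)
  qed
qed

lemma equiv_scale_rel: "equiv (unit_seqs P Q) (scale_rel P Q :: ((int \<Rightarrow> 'a) \<times> (int \<Rightarrow> 'a)) set)"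
proof (rule equivI)
  show "refl_on (unit_seqs P Q) (scale_rel P Q :: ((int \<Rightarrow> 'a) \<times> _) set)"
    by (auto simp: refl_on_def scale_rel_def intro!: exI[of _ 1])
  show "sym (scale_rel P Q :: ((int \<Rightarrow> 'a) \<times> _) set)"
  proof (rule symI)
    fix w v :: "int \<Rightarrow> 'a" assume "(w, v) \<in> scale_rel P Q"
    then obtain c where "w \<in> unit_seqs P Q" "v \<in> unit_seqs P Q" "c \<noteq> 0" "\<And>n. w n = c * v n"
      by (auto simp: scale_rel_def)
    then show "(v, w) \<in> scale_rel P Q"
      by (auto simp: scale_rel_def intro!: exI[of _ "inverse c"])
  qed
  show "trans (scale_rel P Q :: ((int \<Rightarrow> 'a) \<times> _) set)"
  proof (rule transI)
    fix u w v :: "int \<Rightarrow> 'a" assume "(u, w) \<in> scale_rel P Q" "(w, v) \<in> scale_rel P Q"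
    then obtain c d where "u \<in> unit_seqs P Q" "v \<in> unit_seqs P Q" "c \<noteq> 0" "\<And>n. u n = c * w n"
      "d \<noteq> 0" "\<And>n. w n = d * v n"
      unfolding scale_rel_def mem_Collect_eq case_prod_conv by blast
    then show "(u, v) \<in> scale_rel P Q"
      by (auto simp: scale_rel_def intro!: exI[of _ "c * d"])
  qed
qed (auto simp: scale_rel_def)

lemma equiv_shift_rel: "equiv (unit_seqs P Q) (shift_rel P Q :: ((int \<Rightarrow> 'a) \<times> (int \<Rightarrow> 'a)) set)"
proof (rule equivI)
  show "refl_on (unit_seqs P Q) (shift_rel P Q :: ((int \<Rightarrow> 'a) \<times> _) set)"
    unfolding refl_on_def shift_rel_def by (auto, metis add.right_neutral mult_1 zero_neq_one)
  show "sym (shift_rel P Q :: ((int \<Rightarrow> 'a) \<times> _) set)"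
  proof (rule symI)
    fix w v :: "int \<Rightarrow> 'a" assume "(w, v) \<in> shift_rel P Q"
    then obtain c k where "w \<in> unit_seqs P Q" "v \<in> unit_seqs P Q" "c \<noteq> 0" "\<And>n. w n = c * v (n + k)"
      by (auto simp: shift_rel_def)
    then show "(v, w) \<in> shift_rel P Q"
      by (auto simp: shift_rel_def intro!: exI[of _ "inverse c"] exI[of _ "- k"])
  qed
  show "trans (shift_rel P Q :: ((int \<Rightarrow> 'a) \<times> _) set)"
  proof (rule transI)
    fix u w v :: "int \<Rightarrow> 'a" assume "(u, w) \<in> shift_rel P Q" "(w, v) \<in> shift_rel P Q"
    then obtain c d k l where "u \<in> unit_seqs P Q" "v \<in> unit_seqs P Q" "c \<noteq> 0" "\<And>n. u n = c * w (n + k)"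
      "d \<noteq> 0" "\<And>n. w n = d * v (n + l)"
      by (auto simp: shift_rel_def)
    then show "(u, v) \<in> shift_rel P Q"
      by (auto simp: shift_rel_def add.assoc intro!: exI[of _ "c * d"] exI[of _ "k + l"])
  qed
qed (auto simp: shift_rel_def)

lemma scale_rel_mult:
  fixes w w' v :: "int \<Rightarrow> 'a"
  assumes "(w, w') \<in> scale_rel P Q" "v \<in> unit_seqs P Q"
  shows "(seq_mult P Q w v, seq_mult P Q w' v) \<in> scale_rel P Q"
proof -
  obtain c where *: "w \<in> unit_seqs P Q" "w' \<in> unit_seqs P Q" "c \<noteq> 0" "\<And>n. w n = c * w' n"
    using assms by (auto simp: scale_rel_def)
  then have "seq_mult P Q w v n = c * seq_mult P Q w' v n" for n
    by (simp add: seq_mult_eq unit_seqs_def algebra_simps)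
  with * assms(2) show ?thesis by (auto simp: scale_rel_def seq_mult_unit)
qed

lemma shift_rel_mult:
  fixes w w' v :: "int \<Rightarrow> 'a"
  assumes "(w, w') \<in> shift_rel P Q" "v \<in> unit_seqs P Q"
  shows "(seq_mult P Q w v, seq_mult P Q w' v) \<in> shift_rel P Q"
proof -
  obtain c k where *: "w \<in> unit_seqs P Q" "w' \<in> unit_seqs P Q" "c \<noteq> 0" "\<And>n. w n = c * w' (n + k)"
    using assms by (auto simp: shift_rel_def)
  then have "seq_mult P Q w v n = c * seq_mult P Q w' v (n + k)" for n
    by (simp add: seq_mult_eq unit_seqs_def algebra_simps)
  with * assms(2) show ?thesis by (auto simp: shift_rel_def seq_mult_unit)
qed

lemma scale_rel_subset_shift_rel: "scale_rel P Q \<subseteq> (shift_rel P Q :: ((int \<Rightarrow> 'a) \<times> _) set)"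
  unfolding scale_rel_def shift_rel_def by (auto, metis add.right_neutral)

lemma comm_group_G: "comm_group (G_grp P Q :: (int \<Rightarrow> 'a) set monoid)"
  unfolding G_grp_def by (intro seq_quot_comm_group equiv_scale_rel scale_rel_mult)

lemma comm_group_Gstar: "comm_group (Gstar_grp P Q :: (int \<Rightarrow> 'a) set monoid)"
  unfolding Gstar_grp_def by (intro seq_quot_comm_group equiv_shift_rel shift_rel_mult)

section \<open>Classes described by their initial terms\<close>

lemma carrier_G: "carrier (G_grp P Q) = {cls P Q a b | a b :: 'a. Lam P Q a b \<noteq> 0}"
proof -
  have "unit_seqs P Q = {seq_of P Q a b | a b :: 'a. Lam P Q a b \<noteq> 0}"
    by (auto simp: seq_of_unit_iff) (metis (mono_tags, lifting) unit_seqs_def mem_Collect_eq seq_of_eqI)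
  then show ?thesis
    by (auto simp: G_grp_def seq_quot_def quotient_def cls_def)
qed

lemma cls_mult:
  fixes a b c d :: 'a
  assumes "Lam P Q a b \<noteq> 0" "Lam P Q c d \<noteq> 0"
  shows "cls P Q a b \<otimes>\<^bsub>G_grp P Q\<^esub> cls P Q c d =
    cls P Q (a * c - of_int Q * b * d) (b * c + a * d - of_int P * b * d)"
  using seq_quot_mult[OF equiv_scale_rel scale_rel_mult, of "seq_of P Q a b" "seq_of P Q c d"] assms
  by (simp add: cls_def G_grp_def seq_of_unit_iff seq_mult_def)

text \<open>A multiple of a solution is a solution, so by uniqueness proportional initial terms give
  proportional sequences.\<close>

lemma cls_eq_iff:
  fixes a b c d :: 'a
  assumes "Lam P Q a b \<noteq> 0" "Lam P Q c d \<noteq> 0"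
  shows "cls P Q a b = cls P Q c d \<longleftrightarrow> (\<exists>x. x \<noteq> 0 \<and> a = x * c \<and> b = x * d)"
proof -
  have "cls P Q a b = cls P Q c d \<longleftrightarrow> (seq_of P Q a b, seq_of P Q c d) \<in> scale_rel P Q"
    unfolding cls_def using assms
    by (intro eq_equiv_class_iff[OF equiv_scale_rel]) (simp_all add: seq_of_unit_iff)
  also have "\<dots> \<longleftrightarrow> (\<exists>x. x \<noteq> 0 \<and> (\<forall>n. seq_of P Q a b n = x * seq_of P Q c d n))"
    using assms by (auto simp: scale_rel_def seq_of_unit_iff)
  also have "\<dots> \<longleftrightarrow> (\<exists>x. x \<noteq> 0 \<and> a = x * c \<and> b = x * d)"
  proof (intro iff_exI conj_cong refl iffI)
    fix x assume "\<forall>n. seq_of P Q a b n = x * seq_of P Q c d n"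
    then show "a = x * c \<and> b = x * d" by (metis seq_of_0 seq_of_1)
  next
    fix x assume *: "a = x * c \<and> b = x * d"
    have "seq_of P Q c d \<in> rec_seqs P Q" by (rule seq_of_rec)
    then have "x * (seq_of P Q c d (n + 2) - of_int P * seq_of P Q c d (n + 1) +
        of_int Q * seq_of P Q c d n) = 0" for n by (simp add: rec_seqs_def)
    then have "(\<lambda>n. x * seq_of P Q c d n) \<in> rec_seqs P Q"
      by (simp add: rec_seqs_def algebra_simps)
    then have "seq_of P Q a b = (\<lambda>n. x * seq_of P Q c d n)"
      using * by (intro seq_of_eqI) auto
    then show "\<forall>n. seq_of P Q a b n = x * seq_of P Q c d n" by simp
  qed
  finally show ?thesis .
qed

text \<open>Since \<open>scale_rel\<close> relates unit sequences only, a degenerate pair yields the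
  empty set, which is no class. Later this turns membership of a class in a carrier back into a
  condition on the pair.\<close>

lemma cls_empty_iff:
  fixes a b :: 'a
  shows "cls P Q a b = {} \<longleftrightarrow> Lam P Q a b = 0"
proof
  show "Lam P Q a b = 0" if "cls P Q a b = {}"
    using that equiv_class_self[OF equiv_scale_rel, of "seq_of P Q a b"]
    by (auto simp: cls_def seq_of_unit_iff)
  show "cls P Q a b = {}" if "Lam P Q a b = 0"
  proof -
    have "seq_of P Q a b \<notin> unit_seqs P Q" using that by (simp add: seq_of_unit_iff)
    then show ?thesis by (auto simp: cls_def scale_rel_def)
  qed
qed

text \<open>\<open>to_star\<close> takes the image of a whole set; scaling is finer than shifting,
  so all members of the set have the same shift class.\<close>

lemma to_star_cls:
  fixes a b :: 'a
  assumes "Lam P Q a b \<noteq> 0"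
  shows "to_star P Q (cls P Q a b) = shift_rel P Q `` {seq_of P Q a b}"
proof -
  have u: "seq_of P Q a b \<in> unit_seqs P Q" using assms by (simp add: seq_of_unit_iff)
  have "shift_rel P Q `` {w} = shift_rel P Q `` {seq_of P Q a b}" if "w \<in> cls P Q a b" for w
    using that scale_rel_subset_shift_rel equiv_class_eq[OF equiv_shift_rel] by (fastforce simp: cls_def)
  moreover have "seq_of P Q a b \<in> cls P Q a b"
    using u equiv_class_self[OF equiv_scale_rel] by (simp add: cls_def)
  ultimately show ?thesis unfolding to_star_def by blast
qed

lemma to_star_hom: "to_star P Q \<in> hom (G_grp P Q) (Gstar_grp P Q :: (int \<Rightarrow> 'a) set monoid)"
proof (rule homI)
  fix A B :: "(int \<Rightarrow> 'a) set" assume "A \<in> carrier (G_grp P Q)" "B \<in> carrier (G_grp P Q)"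
  then obtain a b c d where *: "A = cls P Q a b" "B = cls P Q c d" "Lam P Q a b \<noteq> 0" "Lam P Q c d \<noteq> 0"
    by (auto simp: carrier_G)
  show "to_star P Q A \<in> carrier (Gstar_grp P Q)"
    using * by (simp add: to_star_cls Gstar_grp_def seq_quot_def quotientI seq_of_unit_iff)
  have u: "seq_of P Q a b \<in> unit_seqs P Q" "seq_of P Q c d \<in> unit_seqs P Q"
    using * by (simp_all add: seq_of_unit_iff)
  have "to_star P Q (A \<otimes>\<^bsub>G_grp P Q\<^esub> B) = shift_rel P Q `` {seq_mult P Q (seq_of P Q a b) (seq_of P Q c d)}"
    using * by (simp add: cls_mult to_star_cls Lam_mult seq_mult_def)
  also have "\<dots> = to_star P Q A \<otimes>\<^bsub>Gstar_grp P Q\<^esub> to_star P Q B"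
    using seq_quot_mult[OF equiv_shift_rel shift_rel_mult u] *
    by (simp add: to_star_cls Gstar_grp_def)
  finally show "to_star P Q (A \<otimes>\<^bsub>G_grp P Q\<^esub> B) = to_star P Q A \<otimes>\<^bsub>Gstar_grp P Q\<^esub> to_star P Q B" .
qed

lemma cls_to_proj_cls:
  fixes a b :: 'a
  assumes "Lam P Q a b \<noteq> 0"
  shows "cls_to_proj (cls P Q a b) = proj_pt a b"
proof -
  have *: "Lam P Q (c * a) (c * b) = c\<^sup>2 * Lam P Q a b" for c
    by (simp add: Lam_def power2_eq_square algebra_simps)
  \<comment> \<open>Every scaled pair is realised inside the class, so the class fills the whole
    punctured line.\<close>
  have sc: "seq_of P Q (c * a) (c * b) \<in> cls P Q a b" if "c \<noteq> 0" for c
  proof -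
    have "Lam P Q (c * a) (c * b) \<noteq> 0" using that assms * by simp
    moreover from this have "cls P Q (c * a) (c * b) = cls P Q a b" using that assms by (subst cls_eq_iff) auto
    ultimately show ?thesis using equiv_class_self[OF equiv_scale_rel, of "seq_of P Q (c * a) (c * b)"]
      by (simp add: cls_def seq_of_unit_iff)
  qed
  show ?thesis
  proof (intro equalityI subsetI)
    fix x assume "x \<in> cls_to_proj (cls P Q a b)"
    then obtain w c where "x = (w 1, w 0)" "c \<noteq> 0" "\<forall>n. seq_of P Q a b n = c * w n"
      by (auto simp: cls_to_proj_def cls_def scale_rel_def)
    moreover from this(3) have "a = c * w 1" "b = c * w 0" by (metis seq_of_1, metis seq_of_0)
    ultimately show "x \<in> proj_pt a b"
      by (auto simp: proj_pt_def intro!: exI[of _ "inverse c"])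
  next
    fix x assume "x \<in> proj_pt a b"
    then obtain c where "c \<noteq> 0" "x = (c * a, c * b)" by (auto simp: proj_pt_def)
    then show "x \<in> cls_to_proj (cls P Q a b)"
      using sc[of c] by (auto simp: cls_to_proj_def intro!: image_eqI[of _ _ "seq_of P Q (c * a) (c * b)"])
  qed
qed

end

section \<open>Integral representatives and reduction modulo \<open>p\<close>\<close>

lemma proj_pt_eq_iff:
  fixes a b c d :: "'a::field"
  assumes "(a, b) \<noteq> (0, 0)" "(c, d) \<noteq> (0, 0)"
  shows "proj_pt a b = proj_pt c d \<longleftrightarrow> a * d = b * c"
proof
  assume "proj_pt a b = proj_pt c d"
  moreover have "(a, b) \<in> proj_pt a b" by (auto simp: proj_pt_def intro!: exI[of _ 1])
  ultimately show "a * d = b * c" by (auto simp: proj_pt_def)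
next
  assume *: "a * d = b * c"
  have "\<exists>x. x \<noteq> 0 \<and> a = x * c \<and> b = x * d"
  \<comment> \<open>The scalar is the ratio of the coordinates at a place where
    \<open>(c, d)\<close> does not vanish.\<close>
  proof (cases "c = 0")
    case True
    with * assms have "d \<noteq> 0" "a = 0" "b \<noteq> 0" by auto
    with True show ?thesis by (auto intro!: exI[of _ "b / d"])
  next
    case False
    with * assms have "a \<noteq> 0" by auto
    with False * show ?thesis by (auto intro!: exI[of _ "a / c"] simp: field_simps)
  qed
  then obtain x where x: "x \<noteq> 0" "a = x * c" "b = x * d" by blast
  show "proj_pt a b = proj_pt c d"
  proof (intro equalityI subsetI)
    fix z assume "z \<in> proj_pt a b"
    then obtain y where "y \<noteq> 0" "z = (y * a, y * b)" by (auto simp: proj_pt_def)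
    with x show "z \<in> proj_pt c d" by (auto simp: proj_pt_def intro!: exI[of _ "y * x"])
  next
    fix z assume "z \<in> proj_pt c d"
    then obtain y where "y \<noteq> 0" "z = (y * c, y * d)" by (auto simp: proj_pt_def)
    with x show "z \<in> proj_pt a b" by (auto simp: proj_pt_def intro!: exI[of _ "y / x"])
  qed
qed

text \<open>The integral form of \<open>Lam\<close>, for which divisibility by \<open>p\<close>
  makes sense.\<close>

definition norm_form :: "int \<Rightarrow> int \<Rightarrow> int \<Rightarrow> int \<Rightarrow> int" where
  "norm_form P Q a b = a\<^sup>2 - P * b * a + Q * b\<^sup>2"

lemma Lam_of_int: "Lam P Q (of_int a) (of_int b) = of_int (norm_form P Q a b)"
  by (simp add: Lam_def norm_form_def)

lemma norm_form_scale: "norm_form P Q (k * a) (k * b) = k\<^sup>2 * norm_form P Q a b"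
  by (simp add: norm_form_def power2_eq_square algebra_simps)

lemma norm_form_mult: "norm_form P Q (a * c - Q * b * d) (b * c + a * d - P * b * d) =
    norm_form P Q a b * norm_form P Q c d"
  by (simp add: norm_form_def power2_eq_square algebra_simps)

lemma norm_form_conj: "norm_form P Q (a - P * b) (- b) = norm_form P Q a b"
  by (simp add: norm_form_def power2_eq_square algebra_simps)

text \<open>The shifted pair belongs to the conjugate root times \<open>a - b * \<theta>\<close>,
  and the pair \<open>(Q * b, P * b - a)\<close> of the next identity to
  \<open>\<theta> * (a - b * \<theta>)\<close>; both roots have norm \<open>Q\<close>.\<close>

lemma norm_form_shift: "norm_form P Q (P * a - Q * b) a = Q * norm_form P Q a b"
  by (simp add: norm_form_def power2_eq_square algebra_simps)

lemma norm_form_unshift: "norm_form P Q (Q * b) (P * b - a) = Q * norm_form P Q a b"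
  by (simp add: norm_form_def power2_eq_square algebra_simps)

lemma coprime_quotients:
  fixes a b :: int
  assumes "(a, b) \<noteq> (0, 0)"
  obtains k c d where "k \<noteq> 0" "coprime c d" "a = k * c" "b = k * d"
proof -
  have "gcd a b \<noteq> 0" using assms by auto
  moreover from this have "coprime (a div gcd a b) (b div gcd a b)" by (intro div_gcd_coprime) auto
  ultimately show ?thesis using that[of "gcd a b" "a div gcd a b" "b div gcd a b"] by simp
qed

lemma (in comm_group) subgroup_comm_group:
  assumes "subgroup H G"
  shows "comm_group (G\<lparr>carrier := H\<rparr>)"
  using assms subgroup.subset[OF assms] by (intro group.group_comm_groupI subgroup_imp_group) (auto intro: m_comm)

section \<open>Classes of integer pairs at the prime \<open>p\<close>\<close>

locale lucas_prime =
  fixes P Q p :: int and ty :: "'p::prime_card itself"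
  assumes p_eq: "p = int CARD('p)" and p_ndvd_Q: "\<not> p dvd Q"
begin

lemma of_int_eq_0_iff_p_dvd: "(of_int a :: 'p mod_ring) = 0 \<longleftrightarrow> p dvd a"
  using of_int_eq_0_iff_char_dvd[where 'a = "'p mod_ring"] by (simp add: p_eq)

sublocale rat: lucas_field P Q "TYPE(rat)"
  by unfold_locales (use p_ndvd_Q in auto)

sublocale fp: lucas_field P Q "TYPE('p mod_ring)"
  by unfold_locales (use p_ndvd_Q in \<open>simp add: of_int_eq_0_iff_p_dvd\<close>)

abbreviation "N \<equiv> norm_form P Q"
abbreviation pcls :: "int \<Rightarrow> int \<Rightarrow> (int \<Rightarrow> rat) set" where
  "pcls a b \<equiv> cls P Q (of_int a) (of_int b)"
abbreviation pstar :: "int \<Rightarrow> int \<Rightarrow> (int \<Rightarrow> rat) set" where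
  "pstar a b \<equiv> to_star P Q (pcls a b)"
abbreviation "GG \<equiv> G_grp P Q :: (int \<Rightarrow> rat) set monoid"
abbreviation "GS \<equiv> Gstar_grp P Q :: (int \<Rightarrow> rat) set monoid"
abbreviation "KK \<equiv> K_sub P Q ty"
abbreviation "HH \<equiv> G_sub P Q ty"

lemma prime_p: "prime p"
  unfolding p_eq by (rule prime_card_int)

lemma N_nz: "\<not> p dvd N a b \<Longrightarrow> N a b \<noteq> 0"
  by auto

lemma N_mult_unit: "\<not> p dvd N a b \<Longrightarrow> \<not> p dvd N c d \<Longrightarrow>
    \<not> p dvd N (a * c - Q * b * d) (b * c + a * d - P * b * d)"
  by (simp add: norm_form_mult prime_dvd_mult_iff[OF prime_p])

lemma N_shift_unit: "\<not> p dvd N (P * a - Q * b) a \<longleftrightarrow> \<not> p dvd N a b"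
  by (simp add: norm_form_shift prime_dvd_mult_iff[OF prime_p] p_ndvd_Q)

lemma N_unshift_unit: "\<not> p dvd N (Q * b) (P * b - a) \<longleftrightarrow> \<not> p dvd N a b"
  by (simp add: norm_form_unshift prime_dvd_mult_iff[OF prime_p] p_ndvd_Q)

lemma Q_nonzero: "Q \<noteq> 0"
  using p_ndvd_Q by auto

lemma pcls_in_carrier_iff: "pcls a b \<in> carrier GG \<longleftrightarrow> N a b \<noteq> 0"
proof
  assume "pcls a b \<in> carrier GG"
  then have "pcls a b \<noteq> {}" unfolding rat.carrier_G mem_Collect_eq by (metis rat.cls_empty_iff)
  then show "N a b \<noteq> 0" by (simp add: rat.cls_empty_iff Lam_of_int)
next
  assume "N a b \<noteq> 0"
  then have "Lam P Q (of_int a) (of_int b) \<noteq> (0::rat)" by (simp add: Lam_of_int)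
  then show "pcls a b \<in> carrier GG" by (auto simp: rat.carrier_G)
qed

lemma pcls_mult:
  assumes "N a b \<noteq> 0" "N c d \<noteq> 0"
  shows "pcls a b \<otimes>\<^bsub>GG\<^esub> pcls c d = pcls (a * c - Q * b * d) (b * c + a * d - P * b * d)"
  using rat.cls_mult[of "of_int a" "of_int b" "of_int c" "of_int d"] assms by (simp add: Lam_of_int)

lemma pcls_eqI:
  fixes x :: rat
  assumes N: "N a b \<noteq> 0" "N c d \<noteq> 0" and x: "x \<noteq> 0" "of_int a = x * of_int c" "of_int b = x * of_int d"
  shows "pcls a b = pcls c d"
proof -
  have "Lam P Q (of_int a) (of_int b) \<noteq> (0::rat)" "Lam P Q (of_int c) (of_int d) \<noteq> (0::rat)"
    unfolding Lam_of_int using N by simp_all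
  from rat.cls_eq_iff[OF this] x show ?thesis by blast
qed

text \<open>A class is determined by its point of the projective line, and equality of points is the
  vanishing of a determinant, which descends from the rationals to the integers.\<close>

lemma pcls_eq_iff:
  assumes "N a b \<noteq> 0" "N c d \<noteq> 0"
  shows "pcls a b = pcls c d \<longleftrightarrow> a * d = b * c"
proof -
  have "pcls a b = pcls c d \<longleftrightarrow> cls_to_proj (pcls a b) = cls_to_proj (pcls c d)"
  proof
    assume eq: "cls_to_proj (pcls a b) = cls_to_proj (pcls c d)"
    have "proj_pt (of_int a) (of_int b) = (proj_pt (of_int c) (of_int d) :: (rat \<times> rat) set)"
      using eq assms by (simp add: rat.cls_to_proj_cls Lam_of_int)
    moreover have "(of_int a, of_int b) \<in> (proj_pt (of_int a) (of_int b) :: (rat \<times> rat) set)"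
      by (auto simp: proj_pt_def intro!: exI[of _ 1])
    ultimately obtain x :: rat where "x \<noteq> 0" "of_int a = x * of_int c" "of_int b = x * of_int d"
      by (auto simp: proj_pt_def)
    then show "pcls a b = pcls c d"
      using assms by (intro pcls_eqI)
  qed simp
  also have "\<dots> \<longleftrightarrow> proj_pt (of_int a) (of_int b) = (proj_pt (of_int c) (of_int d) :: (rat \<times> rat) set)"
    using assms by (simp add: rat.cls_to_proj_cls Lam_of_int)
  also have "\<dots> \<longleftrightarrow> (of_int a * of_int d :: rat) = of_int b * of_int c"
    using assms by (intro proj_pt_eq_iff) (auto simp: norm_form_def)
  also have "\<dots> \<longleftrightarrow> a * d = b * c"
    by (metis of_int_eq_iff of_int_mult)
  finally show ?thesis .
qed

text \<open>No condition on the norm is imposed, since both sides are empty when it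
  vanishes.\<close>

lemma pcls_scale:
  assumes "k \<noteq> 0"
  shows "pcls (k * a) (k * b) = pcls a b"
proof (cases "N a b = 0")
  case True
  then have "pcls (k * a) (k * b) = {}" "pcls a b = {}"
    unfolding rat.cls_empty_iff Lam_of_int norm_form_scale by simp_all
  then show ?thesis by simp
next
  case False
  then show ?thesis using assms by (subst pcls_eq_iff) (auto simp: norm_form_scale)
qed

text \<open>Clearing the denominators and dividing by the gcd are both scalings; \<open>m\<close>
  below is the common denominator.\<close>

lemma coprime_rep:
  assumes "A \<in> carrier GG"
  obtains a b where "coprime a b" "N a b \<noteq> 0" "A = pcls a b"
proof -
  obtain u v :: rat where A: "A = cls P Q u v" and L: "Lam P Q u v \<noteq> 0"
    using assms by (auto simp: rat.carrier_G)
  obtain x y where u: "u = of_int x / of_int y" "y \<noteq> 0"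
    using quotient_of_div[of u] quotient_of_denom_pos by (metis less_irrefl prod.collapse)
  obtain z t where v: "v = of_int z / of_int t" "t \<noteq> 0"
    using quotient_of_div[of v] quotient_of_denom_pos by (metis less_irrefl prod.collapse)
  define m :: rat where "m = of_int y * of_int t"
  have m: "m \<noteq> 0" using u v by (simp add: m_def)
  have uv: "of_int (x * t) = m * u" "of_int (z * y) = m * v"
    using u v by (simp_all add: m_def)
  have "Lam P Q (m * u) (m * v) = m\<^sup>2 * Lam P Q u v"
    by (simp add: Lam_def power2_eq_square algebra_simps)
  then have N1: "Lam P Q (m * u) (m * v) \<noteq> 0" using m L by simp
  then have A': "A = pcls (x * t) (z * y)"
    unfolding A uv using L m by (subst rat.cls_eq_iff) (auto intro!: exI[of _ "inverse m"])
  have N2: "N (x * t) (z * y) \<noteq> 0" using N1 unfolding uv[symmetric] Lam_of_int by simp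
  then have "(x * t, z * y) \<noteq> (0, 0)" by (auto simp: norm_form_def)
  then obtain k c d where k: "k \<noteq> 0" "coprime c d" "x * t = k * c" "z * y = k * d"
    by (rule coprime_quotients)
  have "N c d \<noteq> 0" using N2 unfolding k norm_form_scale by auto
  moreover have "A = pcls c d" unfolding A' k(3,4) by (rule pcls_scale[OF k(1)])
  ultimately show ?thesis using that k(2) by blast
qed

lemma coprime_nonzero_mod:
  assumes "coprime a b"
  shows "(of_int a, of_int b) \<noteq> (0 :: 'p mod_ring, 0 :: 'p mod_ring)"
proof -
  have "\<not> (p dvd a \<and> p dvd b)"
    using assms prime_p by (metis coprime_common_divisor not_prime_unit)
  then show ?thesis by (simp add: of_int_eq_0_iff_p_dvd)
qed

text \<open>Two coprime representatives of one class satisfy the integer identity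
  \<open>a * d = b * c\<close>, which survives reduction; by coprimality neither pair reduces to
  \<open>(0, 0)\<close>, so the determinant test applies modulo \<open>p\<close>. This makes the
  description in \<open>red\<close> unique.\<close>

lemma red_pcls:
  assumes "coprime a b" "N a b \<noteq> 0"
  shows "red P Q (pcls a b) = (proj_pt (of_int a) (of_int b) :: ('p mod_ring \<times> 'p mod_ring) set)"
  unfolding red_def
proof (rule the_equality)
  show "\<exists>c d. coprime c d \<and> pcls a b = pcls c d \<and>
      proj_pt (of_int a) (of_int b) = (proj_pt (of_int c) (of_int d) :: ('p mod_ring \<times> 'p mod_ring) set)"
    using assms by blast
next
  fix x :: "('p mod_ring \<times> 'p mod_ring) set"
  assume "\<exists>c d. coprime c d \<and> pcls a b = pcls c d \<and> x = proj_pt (of_int c) (of_int d)"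
  then obtain c d where cd: "coprime c d" "pcls a b = pcls c d" "x = proj_pt (of_int c) (of_int d)"
    by blast
  have "N c d \<noteq> 0" using cd(2) assms(2) by (metis pcls_in_carrier_iff)
  then have "a * d = b * c" using cd(2) assms(2) pcls_eq_iff by blast
  then have "(of_int a * of_int d :: 'p mod_ring) = of_int b * of_int c"
    by (metis of_int_mult)
  then show "x = proj_pt (of_int a) (of_int b)"
    unfolding cd(3) using assms cd coprime_nonzero_mod by (subst eq_commute, subst proj_pt_eq_iff) auto
qed

text \<open>\<open>Lam\<close> is a quadratic form, so its vanishing depends only on the projective
  point; it can be tested on the reduced coordinates themselves, where it is the norm modulo
  \<open>p\<close>.\<close>

lemma coprime_pcls_in_K_iff:
  assumes "coprime a b"
  shows "pcls a b \<in> KK \<longleftrightarrow> \<not> p dvd N a b"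
proof (cases "N a b = 0")
  case True
  then show ?thesis by (simp add: K_sub_def pcls_in_carrier_iff)
next
  case False
  have img: "cls_to_proj ` carrier (G_grp P Q) =
      {proj_pt c d | c d :: 'p mod_ring. Lam P Q c d \<noteq> 0}"
  proof (intro equalityI subsetI)
    fix x assume "x \<in> cls_to_proj ` carrier (G_grp P Q :: (int \<Rightarrow> 'p mod_ring) set monoid)"
    then show "x \<in> {proj_pt c d | c d :: 'p mod_ring. Lam P Q c d \<noteq> 0}"
      by (auto simp: fp.carrier_G fp.cls_to_proj_cls; blast)
  next
    fix x assume "x \<in> {proj_pt c d | c d :: 'p mod_ring. Lam P Q c d \<noteq> 0}"
    then obtain c d :: "'p mod_ring" where "x = proj_pt c d" "Lam P Q c d \<noteq> 0" by blast
    then show "x \<in> cls_to_proj ` carrier (G_grp P Q)"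
      by (auto simp: fp.carrier_G fp.cls_to_proj_cls intro!: image_eqI[of _ _ "cls P Q c d"])
  qed
  have "pcls a b \<in> KK \<longleftrightarrow> (\<exists>c d :: 'p mod_ring. Lam P Q c d \<noteq> 0 \<and>
      proj_pt (of_int a) (of_int b) = proj_pt c d)"
    using False assms by (auto simp: K_sub_def red_pcls img pcls_in_carrier_iff)
  also have "\<dots> \<longleftrightarrow> Lam P Q (of_int a) (of_int b :: 'p mod_ring) \<noteq> 0"
  proof
    assume "\<exists>c d :: 'p mod_ring. Lam P Q c d \<noteq> 0 \<and> proj_pt (of_int a) (of_int b) = proj_pt c d"
    then obtain c d :: "'p mod_ring" where cd: "Lam P Q c d \<noteq> 0"
      "proj_pt (of_int a) (of_int b) = proj_pt c d" by blast
    have "(of_int a, of_int b) \<in> (proj_pt (of_int a) (of_int b) :: ('p mod_ring \<times> 'p mod_ring) set)"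
      by (auto simp: proj_pt_def intro!: exI[of _ 1])
    with cd obtain x where x: "x \<noteq> 0" "of_int a = x * c" "of_int b = x * d"
      by (auto simp: proj_pt_def)
    have "Lam P Q (x * c) (x * d) = x\<^sup>2 * Lam P Q c d"
      by (simp add: Lam_def power2_eq_square algebra_simps)
    with x cd show "Lam P Q (of_int a) (of_int b :: 'p mod_ring) \<noteq> 0" by simp
  qed blast
  also have "\<dots> \<longleftrightarrow> \<not> p dvd N a b"
    by (simp add: Lam_of_int of_int_eq_0_iff_p_dvd)
  finally show ?thesis .
qed

lemma coprime_pcls_in_H_iff:
  assumes "coprime a b"
  shows "pcls a b \<in> HH \<longleftrightarrow> N a b \<noteq> 0 \<and> p dvd b"
proof (cases "N a b = 0")
  case True
  then show ?thesis by (simp add: G_sub_def pcls_in_carrier_iff)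
next
  case False
  then have "pcls a b \<in> HH \<longleftrightarrow> proj_pt (of_int a) (of_int b) = (proj_pt 1 0 :: ('p mod_ring \<times> 'p mod_ring) set)"
    using assms by (simp add: G_sub_def red_pcls pcls_in_carrier_iff)
  also have "\<dots> \<longleftrightarrow> p dvd b"
    using coprime_nonzero_mod[OF assms] by (subst proj_pt_eq_iff) (auto simp: of_int_eq_0_iff_p_dvd)
  finally show ?thesis using False by simp
qed

text \<open>A common factor \<open>k\<close> enters the norm squared, hence is prime to
  \<open>p\<close> whenever the norm is. Divisibility of the second entry by \<open>p\<close> is
  thus the same before and after \<open>k\<close> is removed, which frees the sequel from
  coprimality.\<close>

lemma reduce_unit:
  assumes "\<not> p dvd N a b"
  obtains k c d where "k \<noteq> 0" "\<not> p dvd k" "coprime c d" "a = k * c" "b = k * d" "\<not> p dvd N c d"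
    "pcls a b = pcls c d"
proof -
  have "(a, b) \<noteq> (0, 0)" using assms by (auto simp: norm_form_def)
  then obtain k c d where k: "k \<noteq> 0" "coprime c d" "a = k * c" "b = k * d"
    by (rule coprime_quotients)
  have "\<not> p dvd k" "\<not> p dvd N c d"
    using assms unfolding k norm_form_scale by (auto simp: power2_eq_square)
  with k show ?thesis using that pcls_scale[OF k(1)] by metis
qed

lemma pcls_in_K: "\<not> p dvd N a b \<Longrightarrow> pcls a b \<in> KK"
  by (erule reduce_unit) (metis coprime_pcls_in_K_iff)

lemma pcls_in_H_iff:
  assumes "\<not> p dvd N a b"
  shows "pcls a b \<in> HH \<longleftrightarrow> p dvd b"
  using assms
proof (rule reduce_unit)
  fix k c d assume k: "\<not> p dvd k" "coprime c d" "b = k * d" "\<not> p dvd N c d" "pcls a b = pcls c d"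
  then have "pcls a b \<in> HH \<longleftrightarrow> p dvd d"
    using coprime_pcls_in_H_iff[of c d] N_nz[of c d] by simp
  also have "\<dots> \<longleftrightarrow> p dvd b"
    using k by (simp add: prime_dvd_mult_iff[OF prime_p])
  finally show ?thesis .
qed

lemma K_rep:
  assumes "A \<in> KK"
  obtains a b where "\<not> p dvd N a b" "A = pcls a b"
proof -
  have "A \<in> carrier GG" using assms by (simp add: K_sub_def)
  then obtain a b where "coprime a b" "A = pcls a b" by (rule coprime_rep)
  then show ?thesis using that assms coprime_pcls_in_K_iff by blast
qed

text \<open>If \<open>p\<close> divides \<open>b\<close>, coprimality makes \<open>a\<close> prime
  to \<open>p\<close>, and the norm is congruent to the square of \<open>a\<close>. This is why
  \<open>G(f,p)\<close> lies in \<open>K(f,p)\<close>.\<close>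

lemma H_rep:
  assumes "A \<in> HH"
  obtains a b where "\<not> p dvd N a b" "p dvd b" "A = pcls a b"
proof -
  have "A \<in> carrier GG" using assms by (simp add: G_sub_def)
  then obtain a b where *: "coprime a b" "A = pcls a b" "N a b \<noteq> 0" by (rule coprime_rep)
  then have b: "p dvd b" using assms coprime_pcls_in_H_iff by blast
  then have "\<not> p dvd a" using *(1) prime_p by (metis coprime_common_divisor not_prime_unit)
  then have "\<not> p dvd N a b"
    using b prime_p by (auto simp: norm_form_def power2_eq_square dvd_add_left_iff
        right_diff_distrib dvd_diff_left_iff prime_dvd_mult_iff)
  then show ?thesis using that * b by blast
qed

lemma K_subset: "KK \<subseteq> carrier GG"
  by (auto simp: K_sub_def)

lemma H_subset_K: "HH \<subseteq> KK"
  by (auto elim!: H_rep intro: pcls_in_K)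

section \<open>The subgroups and their images under shifting\<close>

interpretation GG: comm_group GG by (rule rat.comm_group_G)
interpretation GS: comm_group GS by (rule rat.comm_group_Gstar)

lemma one_G: "\<one>\<^bsub>GG\<^esub> = pcls 1 0"
  by (simp add: G_grp_def seq_quot_def cls_def lucas_def)

text \<open>The product with the conjugate pair is \<open>(N a b, 0)\<close>, a multiple of the
  neutral pair \<open>(1, 0)\<close>.\<close>

lemma inv_pcls:
  assumes "N a b \<noteq> 0"
  shows "inv\<^bsub>GG\<^esub> pcls a b = pcls (a - P * b) (- b)"
proof (rule GG.inv_equality)
  have "pcls (a - P * b) (- b) \<otimes>\<^bsub>GG\<^esub> pcls a b = pcls (N a b * 1) (N a b * 0)"
  proof (subst pcls_mult)
    have "(a - P * b) * a - Q * - b * b = N a b * 1" "- b * a + (a - P * b) * b - P * - b * b = N a b * 0"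
      by (simp_all add: norm_form_def power2_eq_square algebra_simps)
    then show "pcls ((a - P * b) * a - Q * - b * b) (- b * a + (a - P * b) * b - P * - b * b) =
        pcls (N a b * 1) (N a b * 0)" by (simp only:)
  qed (use assms in \<open>simp_all add: norm_form_conj\<close>)
  then show "pcls (a - P * b) (- b) \<otimes>\<^bsub>GG\<^esub> pcls a b = \<one>\<^bsub>GG\<^esub>"
    unfolding one_G pcls_scale[OF assms] .
qed (use assms in \<open>simp_all only: pcls_in_carrier_iff norm_form_conj not_False_eq_True\<close>)

lemma subgroup_K: "subgroup KK GG"
proof (rule GG.subgroupI)
  have "pcls 1 0 \<in> KK" by (rule pcls_in_K) (use prime_p in \<open>auto simp: norm_form_def\<close>)
  then show "KK \<noteq> {}" by blast
next
  fix A assume "A \<in> KK"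
  then show "inv\<^bsub>GG\<^esub> A \<in> KK"
    by (rule K_rep) (simp add: N_nz inv_pcls del: of_int_diff of_int_minus, rule pcls_in_K, simp add: norm_form_conj)
next
  fix A B assume "A \<in> KK" "B \<in> KK"
  then obtain a b c d where *: "\<not> p dvd N a b" "A = pcls a b" "\<not> p dvd N c d" "B = pcls c d"
    by (meson K_rep)
  then show "A \<otimes>\<^bsub>GG\<^esub> B \<in> KK"
    by (simp only: N_nz pcls_mult pcls_in_K N_mult_unit not_False_eq_True)
qed (rule K_subset)

lemma subgroup_H: "subgroup HH GG"
proof (rule GG.subgroupI)
  show "HH \<subseteq> carrier GG" using H_subset_K K_subset by blast
  have *: "\<not> p dvd N 1 0" using prime_p by (auto simp: norm_form_def)
  have "pcls 1 0 \<in> HH" using pcls_in_H_iff[OF *] by simp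
  then show "HH \<noteq> {}" by blast
next
  fix A assume "A \<in> HH"
  then obtain a b where *: "\<not> p dvd N a b" "p dvd b" "A = pcls a b" by (rule H_rep)
  have "\<not> p dvd N (a - P * b) (- b)" using * by (simp add: norm_form_conj)
  from pcls_in_H_iff[OF this] * show "inv\<^bsub>GG\<^esub> A \<in> HH" by (simp only: N_nz inv_pcls not_False_eq_True dvd_minus_iff)
next
  fix A B assume "A \<in> HH" "B \<in> HH"
  then obtain a b c d where *: "\<not> p dvd N a b" "A = pcls a b" "\<not> p dvd N c d" "B = pcls c d" "p dvd b" "p dvd d"
    by (meson H_rep)
  have "p dvd b * c + a * d - P * b * d" using * by simp
  with pcls_in_H_iff[OF N_mult_unit[OF *(1,3)]] show "A \<otimes>\<^bsub>GG\<^esub> B \<in> HH"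
    using * by (simp only: N_nz pcls_mult not_False_eq_True)
qed

lemma group_hom_star: "group_hom GG GS (to_star P Q)"
  by (simp add: group_hom_def group_hom_axioms_def rat.to_star_hom GG.is_group GS.is_group)

lemma subgroup_Kstar: "subgroup (Kstar_sub P Q ty) GS"
  unfolding Kstar_sub_def by (rule group_hom.subgroup_img_is_subgroup[OF group_hom_star subgroup_K])

lemma subgroup_Gstar: "subgroup (Gstar_sub P Q ty) GS"
  unfolding Gstar_sub_def by (rule group_hom.subgroup_img_is_subgroup[OF group_hom_star subgroup_H])

lemma subgroup_H_K: "subgroup HH (K_grp P Q ty)"
  unfolding K_grp_def by (rule GG.subgroup_incl[OF subgroup_H subgroup_K H_subset_K])

lemma subgroup_Gstar_Kstar: "subgroup (Gstar_sub P Q ty) (Kstar_grp P Q ty)"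
  unfolding Kstar_grp_def
  by (rule GS.subgroup_incl[OF subgroup_Gstar subgroup_Kstar])
    (use H_subset_K in \<open>auto simp: Gstar_sub_def Kstar_sub_def\<close>)

lemma comm_group_K: "comm_group (K_grp P Q ty)"
  unfolding K_grp_def by (rule GG.subgroup_comm_group[OF subgroup_K])

lemma comm_group_Kstar: "comm_group (Kstar_grp P Q ty)"
  unfolding Kstar_grp_def by (rule GS.subgroup_comm_group[OF subgroup_Kstar])

lemma pstar_mult:
  assumes "N a b \<noteq> 0" "N c d \<noteq> 0"
  shows "pstar a b \<otimes>\<^bsub>GS\<^esub> pstar c d = pstar (a * c - Q * b * d) (b * c + a * d - P * b * d)"
  using assms hom_mult[OF rat.to_star_hom, of "pcls a b" "pcls c d"] pcls_mult[OF assms]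
  by (simp add: pcls_in_carrier_iff)

lemma pstar_eq_iff:
  assumes "N a b \<noteq> 0" "N c d \<noteq> 0"
  shows "pstar a b = pstar c d \<longleftrightarrow>
    (\<exists>x k. x \<noteq> 0 \<and> (\<forall>n. seq_of P Q (of_int a) (of_int b) n = (x::rat) * seq_of P Q (of_int c) (of_int d) (n + k)))"
proof -
  have u: "seq_of P Q (of_int a) (of_int b :: rat) \<in> unit_seqs P Q"
    "seq_of P Q (of_int c) (of_int d :: rat) \<in> unit_seqs P Q"
    using assms by (simp_all add: rat.seq_of_unit_iff Lam_of_int)
  have "pstar a b = pstar c d \<longleftrightarrow>
      (seq_of P Q (of_int a) (of_int b :: rat), seq_of P Q (of_int c) (of_int d)) \<in> shift_rel P Q"
    using assms eq_equiv_class_iff[OF rat.equiv_shift_rel u] by (simp add: rat.to_star_cls Lam_of_int)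
  then show ?thesis using u by (simp add: shift_rel_def)
qed

lemma pstar_shift:
  assumes "N a b \<noteq> 0"
  shows "pstar (P * a - Q * b) a = pstar a b"
proof -
  define s where "s = seq_of P Q (of_int a) (of_int b :: rat)"
  have rec: "s \<in> rec_seqs P Q" by (simp add: s_def rat.seq_of_rec)
  \<comment> \<open>The new pair consists of the terms of index 2 and 1, so its sequence is the old
    one moved by one place.\<close>
  have "seq_of P Q (of_int (P * a - Q * b)) (of_int a) = (\<lambda>n. s (n + 1))"
    using rat.shift_rec[OF rec, of 1] rat.rec_step[OF rec, of 1]
    by (intro rat.seq_of_eqI) (simp_all add: s_def)
  then show ?thesis
    using assms Q_nonzero
    by (subst pstar_eq_iff) (auto simp: norm_form_shift s_def simp del: of_int_diff of_int_mult
        intro!: exI[of _ 1] exI[of _ "1::int"])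
qed

text \<open>The pair \<open>(Q b, P b - a)\<close> is, up to the factor \<open>Q\<close>, the shift of \<open>(a, b)\<close> by \<open>-1\<close>; the factor
  keeps the invariant \<open>R\<close> within the integers.\<close>

lemma pstar_eq_induct:
  assumes eq: "pstar a b = pstar c d" and N: "N a b \<noteq> 0" "N c d \<noteq> 0"
    and base: "R c d"
    and shift: "\<And>x y. R x y \<Longrightarrow> R (P * x - Q * y) x"
    and unshift: "\<And>x y. R x y \<Longrightarrow> R (Q * y) (P * y - x)"
  obtains x y where "R x y" "pcls a b = pcls x y"
proof -
  obtain z k where z: "z \<noteq> 0" "\<And>n. seq_of P Q (of_int a) (of_int b) n =
      (z::rat) * seq_of P Q (of_int c) (of_int d) (n + k)"
    using eq pstar_eq_iff[OF N] by blast
  define s where "s = seq_of P Q (of_int c) (of_int d :: rat)"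
  have rec: "s \<in> rec_seqs P Q" by (simp add: s_def rat.seq_of_rec)
  \<comment> \<open>The rational scalar \<open>u\<close> collects a factor \<open>1 / Q\<close> at
    each step to the left, so the pair \<open>(x, y)\<close> itself stays integral.\<close>
  have "\<exists>u x y. u \<noteq> 0 \<and> R x y \<and> N x y \<noteq> 0 \<and> s (k + 1) = u * of_int x \<and> s k = u * of_int y"
  proof (induction k rule: int_induct[where k = 0])
    case base
    show ?case using \<open>R c d\<close> N by (intro exI[of _ 1] exI[of _ c] exI[of _ d]) (simp add: s_def)
  next
    case (step1 i)
    then obtain u x y where *: "u \<noteq> 0" "R x y" "N x y \<noteq> 0" "s (i + 1) = u * of_int x" "s i = u * of_int y"
      by blast
    have "s (i + 1 + 1) = u * of_int (P * x - Q * y)"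
      using rat.rec_step[OF rec, of "i + 1"] * by (simp add: algebra_simps)
    with * shift[OF *(2)] Q_nonzero norm_form_shift[of P Q x y] show ?case
      by (intro exI[of _ u] exI[of _ "P * x - Q * y"] exI[of _ x]) simp
  next
    case (step2 i)
    then obtain u x y where *: "u \<noteq> 0" "R x y" "N x y \<noteq> 0" "s (i + 1) = u * of_int x" "s i = u * of_int y"
      by blast
    have "of_int Q * s (i - 1) = of_int P * s i - s (i + 1)"
      using rat.rec_step[OF rec, of i] by simp
    then have "s (i - 1) = u / of_int Q * of_int (P * y - x)"
      using * Q_nonzero by (simp add: field_simps)
    moreover have "s (i - 1 + 1) = u / of_int Q * of_int (Q * y)"
      using * Q_nonzero by simp
    moreover have "N (Q * y) (P * y - x) \<noteq> 0"
      unfolding norm_form_unshift using * Q_nonzero by simp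
    ultimately show ?case using * unshift[OF *(2)] Q_nonzero
      by (intro exI[of _ "u / of_int Q"] exI[of _ "Q * y"] exI[of _ "P * y - x"]) simp
  qed
  then obtain u x y where *: "u \<noteq> 0" "R x y" "N x y \<noteq> 0" "s (k + 1) = u * of_int x" "s k = u * of_int y"
    by blast
  have "of_int a = z * s (1 + k)" "of_int b = z * s k"
    using z(2)[of 1] z(2)[of 0] by (simp_all add: s_def)
  then have "of_int a = (z * u) * of_int x" "of_int b = (z * u) * of_int y"
    using * by (simp_all add: add.commute)
  then have "pcls a b = pcls x y"
    using N * z(1) by (intro pcls_eqI[of a b x y "z * u"]) simp_all
  then show ?thesis using that * by blast
qed

text \<open>Membership in the image only says that some pair in the same shift class has norm prime
  to \<open>p\<close>. As \<open>p\<close> does not divide \<open>Q\<close>, this property is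
  carried along shifts in both directions, up to the given coprime pair; the explicit formula may
  then be applied to it.\<close>

lemma coprime_pstar_in_Kstar:
  assumes "coprime a b" "pstar a b \<in> Kstar_sub P Q ty"
  shows "\<not> p dvd N a b"
proof -
  obtain c d where cd: "\<not> p dvd N c d" "pstar a b = pstar c d"
    using assms(2) by (auto simp: Kstar_sub_def elim!: K_rep)
  \<comment> \<open>A degenerate pair \<open>(a, b)\<close> would give the empty set on the left,
    while the shift class on the right contains its own sequence.\<close>
  have "pstar c d \<noteq> {}"
    using cd equiv_class_self[OF rat.equiv_shift_rel, of "seq_of P Q (of_int c) (of_int d)"]
    by (auto simp: rat.to_star_cls rat.seq_of_unit_iff Lam_of_int N_nz)
  then have "pcls a b \<noteq> {}" using cd(2) by (auto simp: to_star_def)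
  then have "N a b \<noteq> 0" by (simp add: rat.cls_empty_iff Lam_of_int)
  obtain x y where "\<not> p dvd N x y" "pcls a b = pcls x y"
    using pstar_eq_induct[OF cd(2) \<open>N a b \<noteq> 0\<close> N_nz[OF cd(1)], of "\<lambda>x y. \<not> p dvd N x y"]
      cd(1) N_shift_unit N_unshift_unit by metis
  then have "pcls a b \<in> KK" using pcls_in_K by simp
  then show ?thesis using coprime_pcls_in_K_iff[OF assms(1)] by blast
qed

end

section \<open>Cyclic groups and homomorphisms out of the quotients\<close>

text \<open>The powers of \<open>x\<close> exhaust the group, so \<open>x\<close> has order
  \<open>|G|\<close>. The map is built out of the integers, as exponentiation of representatives; it
  is injective by the order of \<open>x\<close> and surjective by counting.\<close>

lemma (in group) cyclic_iso_integer_mod_group: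
  assumes fin: "finite (carrier G)" and x: "x \<in> carrier G"
    and gen: "carrier G = range (\<lambda>i::nat. x [^] i)"
  shows "G \<cong> integer_mod_group (Coset.order G)"
proof -
  define n where "n = Coset.order G"
  have n0: "n > 0" using fin by (simp add: n_def order_gt_0_iff_finite)
  have "carrier G = generate G {x}"
    using generate_pow_on_finite_carrier[OF fin x] gen by (auto simp: image_def)
  then have ordx: "ord x = n"
    using generate_pow_card[OF x] by (simp add: n_def Coset.order_def)
  define h :: "int \<Rightarrow> 'a" where "h i = x [^] i" for i
  have "h \<in> iso (integer_mod_group n) G"
  proof (rule isoI)
    show "h \<in> hom (integer_mod_group n) G"
    proof (rule homI)
      fix i j :: int
      have "int n dvd (i + j) mod int n - (i + j)" by (simp add: mod_eq_dvd_iff[symmetric])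
      then have "x [^] ((i + j) mod int n) = x [^] (i + j)"
        using x ordx by (simp add: int_pow_eq dvd_diff_commute)
      then show "h (i \<otimes>\<^bsub>integer_mod_group n\<^esub> j) = h i \<otimes> h j"
        using x by (simp add: h_def int_pow_mult)
    qed (use x in \<open>simp add: h_def\<close>)
    have inj: "inj_on h {0..<int n}"
    proof (rule inj_onI)
      fix i j assume "i \<in> {0..<int n}" "j \<in> {0..<int n}" "h i = h j"
      moreover from this have "int n dvd j - i"
        using x ordx by (simp add: h_def int_pow_eq)
      then have "j mod int n = i mod int n" by (simp only: mod_eq_dvd_iff)
      ultimately show "i = j" by simp
    qed
    moreover have "h ` {0..<int n} = carrier G"
    proof (rule card_subset_eq[OF fin])
      show "h ` {0..<int n} \<subseteq> carrier G" using x by (auto simp: h_def)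
      show "card (h ` {0..<int n}) = card (carrier G)"
        using card_image[OF inj] by (simp add: n_def Coset.order_def)
    qed
    ultimately show "bij_betw h (carrier (integer_mod_group n)) (carrier G)"
      using n0 by (simp add: bij_betw_def carrier_integer_mod_group)
  qed
  then show ?thesis
    using group.iso_sym[OF group_integer_mod_group] unfolding n_def is_iso_def by blast
qed

text \<open>The coset of a generator generates the quotient, whose order is given by
  Lagrange.\<close>

lemma (in comm_group) cyclic_quotient_iso_integer_mod_group:
  assumes fin: "finite (carrier G)" and x: "x \<in> carrier G"
    and gen: "carrier G = range (\<lambda>i::nat. x [^] i)" and H: "subgroup H G"
  shows "G Mod H \<cong> integer_mod_group (Coset.order G div card H)"
proof -
  interpret H: normal H G using H by (rule subgroup_imp_normal)
  interpret Q: group "G Mod H" by (rule H.factorgroup_is_group)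
  have fH: "finite H" using fin H.subset finite_subset by blast
  have "card H > 0" using fH H.one_closed card_gt_0_iff by blast
  moreover have "Coset.order (G Mod H) * card H = Coset.order G"
    using lagrange[OF H] by (simp add: Coset.order_def FactGroup_def)
  ultimately have ord: "Coset.order (G Mod H) = Coset.order G div card H" by (metis nonzero_mult_div_cancel_right less_not_refl)
  have "carrier (G Mod H) = range (\<lambda>i::nat. (H #> x) [^]\<^bsub>G Mod H\<^esub> i)"
    unfolding carrier_FactGroup H.FactGroup_pow[OF x] by (subst gen) (auto simp: image_def)
  moreover have "H #> x \<in> carrier (G Mod H)" using x by (simp add: carrier_FactGroup)
  moreover have "finite (carrier (G Mod H))" using fin by (simp add: carrier_FactGroup)
  ultimately show ?thesis using Q.cyclic_iso_integer_mod_group ord by metis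
qed

text \<open>With \<open>r\<close> the order of \<open>x\<close> modulo \<open>F\<close>, each
  element of the product is \<open>c * x^i\<close> for exactly one \<open>c\<close> in
  \<open>F\<close> and one \<open>i < r\<close>. In the application \<open>r\<close> is the rank of
  the Lucas sequence.\<close>

lemma (in comm_group) card_subgroup_mult_generate:
  assumes fin: "finite (carrier G)" and x: "x \<in> carrier G" and F: "subgroup F G"
  shows "card (F <#> generate G {x}) = card F * (LEAST n. n > 0 \<and> x [^] n \<in> F)"
proof -
  interpret F: subgroup F G by (rule F)
  define r :: nat where "r = (LEAST n. n > 0 \<and> x [^] n \<in> F)"
  have "Coset.order G > 0 \<and> x [^] Coset.order G \<in> F"
    using fin x by (simp add: order_gt_0_iff_finite pow_order_eq_1)
  then have "r > 0 \<and> x [^] r \<in> F" unfolding r_def by (rule LeastI)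
  then have r: "r > 0" "x [^] r \<in> F" by auto
  have least: "r \<le> n" if "n > 0" "x [^] n \<in> F" for n
    unfolding r_def using that by (intro Least_le) simp
  have powF: "y [^] k \<in> F" if "y \<in> F" for y and k :: nat
    using that by (induction k) auto
  define f where "f = (\<lambda>(c, i::nat). c \<otimes> x [^] i)"
  have "F <#> generate G {x} = f ` (F \<times> {..<r})"
  proof (intro equalityI subsetI)
    fix y assume "y \<in> F <#> generate G {x}"
    then obtain c n where c: "c \<in> F" and y: "y = c \<otimes> x [^] (n::nat)"
      using generate_pow_on_finite_carrier[OF fin x] by (auto simp: set_mult_def)
    \<comment> \<open>Division with remainder by \<open>r\<close>; the power of
      \<open>x [^] r\<close> is absorbed by \<open>F\<close>.\<close>
    have "x [^] n = (x [^] r) [^] (n div r) \<otimes> x [^] (n mod r)"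
      using x by (simp add: nat_pow_pow nat_pow_mult)
    then have "y = f (c \<otimes> (x [^] r) [^] (n div r), n mod r)"
      using x c F.mem_carrier by (simp add: f_def y m_assoc)
    moreover have "(x [^] r) [^] (n div r) \<in> F"
      using r(2) by (rule powF)
    ultimately show "y \<in> f ` (F \<times> {..<r})" using c r(1) by (intro image_eqI) auto
  next
    fix y assume "y \<in> f ` (F \<times> {..<r})"
    then obtain c i where "c \<in> F" "y = c \<otimes> x [^] (i::nat)" by (auto simp: f_def)
    then show "y \<in> F <#> generate G {x}"
      using generate_pow_on_finite_carrier[OF fin x] by (auto simp: set_mult_def)
  qed
  moreover have "inj_on f (F \<times> {..<r})"
  proof -
    have *: "i = j \<and> c = d" if "c \<in> F" "d \<in> F" "i \<le> j" "j < r" "c \<otimes> x [^] i = d \<otimes> x [^] j"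
      for c d and i j :: nat
    proof -
      \<comment> \<open>Cancelling \<open>x [^] i\<close> puts \<open>x [^] (j - i)\<close> into
        \<open>F\<close>; as \<open>j - i < r\<close>, minimality of \<open>r\<close> forces
        \<open>i = j\<close>.\<close>
      have "x [^] j = x [^] (j - i) \<otimes> x [^] i" using that x by (simp add: nat_pow_mult)
      then have "c \<otimes> x [^] i = (d \<otimes> x [^] (j - i)) \<otimes> x [^] i" using that x by (simp add: m_assoc)
      then have c: "c = d \<otimes> x [^] (j - i)" using that x by simp
      then have "x [^] (j - i) = inv d \<otimes> c" using that x by (simp add: m_assoc[symmetric])
      then have "x [^] (j - i) \<in> F" using that by simp
      then have "i = j" using least[of "j - i"] that by (cases "i = j") auto
      with c that show ?thesis by simp
    qed
    show ?thesis
    proof (rule inj_onI, clarsimp simp: f_def)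
      fix c d and i j :: nat
      assume "c \<in> F" "d \<in> F" "i < r" "j < r" "c \<otimes> x [^] i = d \<otimes> x [^] j"
      then show "c = d \<and> i = j" using *[of c d i j] *[of d c j i] by (cases "i \<le> j") auto
    qed
  qed
  ultimately show ?thesis by (simp add: card_image card_cartesian_product r_def)
qed

text \<open>The first isomorphism theorem for a map known only through representing pairs.
  \<open>m1\<close> and \<open>m0\<close> are the entries of the product pair, so the one criterion
  serves \<open>K\<close> and its starred image.\<close>

lemma quot_iso_viaI:
  fixes A :: "'a monoid" and B :: "'b monoid"
  assumes A: "comm_group A" and B: "group B" and M: "subgroup M A"
    and rep: "carrier A = {rep a b | a b. unit a b}"
    and coprime_unit: "\<And>a b. coprime a b \<Longrightarrow> rep a b \<in> carrier A \<Longrightarrow> unit a b"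
    and mult_unit: "\<And>a b c d. unit a b \<Longrightarrow> unit c d \<Longrightarrow> unit (m1 a b c d) (m0 a b c d)"
    and rep_mult: "\<And>a b c d. unit a b \<Longrightarrow> unit c d \<Longrightarrow>
      rep a b \<otimes>\<^bsub>A\<^esub> rep c d = rep (m1 a b c d) (m0 a b c d)"
    and g_closed: "\<And>a b. unit a b \<Longrightarrow> g a b \<in> carrier B"
    and g_mult: "\<And>a b c d. unit a b \<Longrightarrow> unit c d \<Longrightarrow>
      g (m1 a b c d) (m0 a b c d) = g a b \<otimes>\<^bsub>B\<^esub> g c d"
    and g_surj: "\<And>y. y \<in> carrier B \<Longrightarrow> \<exists>a b. unit a b \<and> g a b = y"
    and g_wd: "\<And>a b c d. unit a b \<Longrightarrow> unit c d \<Longrightarrow> rep a b = rep c d \<Longrightarrow> g a b = g c d"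
    and g_ker: "\<And>a b. unit a b \<Longrightarrow> g a b = \<one>\<^bsub>B\<^esub> \<longleftrightarrow> rep a b \<in> M"
  shows "quot_iso_via A M rep B g"
proof -
  interpret A: comm_group A by (rule A)
  interpret B: group B by (rule B)
  interpret M: subgroup M A by (rule M)
  \<comment> \<open>An arbitrary representing pair is chosen; \<open>g_wd\<close> makes the value
    independent of the choice.\<close>
  define h where "h Z = (SOME y. \<exists>a b. unit a b \<and> Z = rep a b \<and> y = g a b)" for Z
  have h: "h (rep a b) = g a b" if "unit a b" for a b
    unfolding h_def
  proof (rule some_equality)
    show "\<exists>a' b'. unit a' b' \<and> rep a b = rep a' b' \<and> g a b = g a' b'" using that by blast
    show "y = g a b" if "\<exists>a' b'. unit a' b' \<and> rep a b = rep a' b' \<and> y = g a' b'" for y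
      using that g_wd \<open>unit a b\<close> by metis
  qed
  have hom: "h \<in> hom A B"
  proof (rule homI)
    fix Z assume "Z \<in> carrier A"
    then show "h Z \<in> carrier B" using h g_closed by (auto simp: rep)
  next
    fix Z Y assume "Z \<in> carrier A" "Y \<in> carrier A"
    then obtain a b c d where "unit a b" "Z = rep a b" "unit c d" "Y = rep c d" by (auto simp: rep)
    then show "h (Z \<otimes>\<^bsub>A\<^esub> Y) = h Z \<otimes>\<^bsub>B\<^esub> h Y"
      by (simp add: rep_mult h mult_unit g_mult)
  qed
  interpret h: group_hom A B h
    by (simp add: group_hom_def group_hom_axioms_def hom A.is_group B.is_group)
  have ker: "kernel A B h = M"
  proof (intro equalityI subsetI)
    fix Z assume "Z \<in> kernel A B h"
    then show "Z \<in> M" by (auto simp: kernel_def rep h g_ker)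
  next
    fix Z assume Z: "Z \<in> M"
    then have "Z \<in> carrier A" by simp
    with Z show "Z \<in> kernel A B h" by (auto simp: kernel_def rep h g_ker)
  qed
  have "h ` carrier A = carrier B"
  proof (intro equalityI subsetI)
    fix y assume "y \<in> carrier B"
    then obtain a b where "unit a b" "g a b = y" using g_surj by blast
    then show "y \<in> h ` carrier A" using h by (auto simp: rep intro!: image_eqI[of _ _ "rep a b"])
  qed auto
  then have iso: "(\<lambda>Z. the_elem (h ` Z)) \<in> iso (A Mod M) B"
    using h.FactGroup_iso_set ker by simp
  moreover have "the_elem (h ` (M #>\<^bsub>A\<^esub> rep a b)) = g a b" if "coprime a b" "rep a b \<in> carrier A" for a b
  proof -
    have u: "unit a b" using that by (rule coprime_unit)
    have "h Z = h (rep a b)" if Z: "Z \<in> M #>\<^bsub>A\<^esub> rep a b" for Z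
    proof -
      obtain m where m: "m \<in> M" "Z = m \<otimes>\<^bsub>A\<^esub> rep a b" using Z unfolding r_coset_def by blast
      then have "h m = \<one>\<^bsub>B\<^esub>" using ker by (auto simp: kernel_def)
      with m \<open>rep a b \<in> carrier A\<close> show ?thesis by simp
    qed
    moreover have "rep a b \<in> M #>\<^bsub>A\<^esub> rep a b" using A.rcos_self[OF that(2) M] .
    ultimately have "h ` (M #>\<^bsub>A\<^esub> rep a b) = {h (rep a b)}" by blast
    then show ?thesis using h u by simp
  qed
  ultimately show ?thesis
    unfolding quot_iso_via_def by (intro bexI[of _ "\<lambda>Z. the_elem (h ` Z)"] allI impI)
qed

section \<open>Iterated shifts of pairs and the rank\<close>

context lucas_prime
begin

text \<open>The companion map of the recurrence, acting on the terms of index \<open>n + 1\<close>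
  and \<open>n\<close>.\<close>

definition shiftp :: "int \<times> int \<Rightarrow> int \<times> int" where
  "shiftp = (\<lambda>(x, y). (P * x - Q * y, x))"

lemma pstar_shiftp_pow:
  assumes "\<not> p dvd N a b" "(shiftp ^^ k) (a, b) = (c, d)"
  shows "\<not> p dvd N c d \<and> pstar c d = pstar a b"
  using assms(2)
proof (induction k arbitrary: c d)
  case 0
  then show ?case using assms by simp
next
  case (Suc k)
  obtain x y where xy: "(shiftp ^^ k) (a, b) = (x, y)" by fastforce
  with Suc have "\<not> p dvd N x y \<and> pstar x y = pstar a b" "c = P * x - Q * y" "d = x"
    by (auto simp: shiftp_def)
  then show ?case using N_shift_unit N_nz pstar_shift by metis
qed

lemma lucas_shiftp: "lucas P Q (int n) = (of_int (snd ((shiftp ^^ n) (1, 0))) :: rat)"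
proof -
  \<comment> \<open>Both of two consecutive terms are carried along so that the induction
    closes.\<close>
  have "lucas P Q (int n + 1) = (of_int (fst ((shiftp ^^ n) (1, 0))) :: rat) \<and>
    lucas P Q (int n) = (of_int (snd ((shiftp ^^ n) (1, 0))) :: rat)"
  proof (induction n)
    case 0
    then show ?case by (simp add: lucas_def)
  next
    case (Suc n)
    have "lucas P Q \<in> (rec_seqs P Q :: (int \<Rightarrow> rat) set)" by (simp add: lucas_def rat.seq_of_rec)
    from rat.rec_step[OF this, of "int n + 1"] Suc show ?case
      by (simp add: shiftp_def add.commute split: prod.splits)
  qed
  then show ?thesis by simp
qed

lemma in_pZp_of_int_iff: "in_pZp (nat p) (of_int m) \<longleftrightarrow> p dvd m"
proof
  assume "in_pZp (nat p) (of_int m)"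
  then obtain a b where b: "\<not> p dvd b" and m: "(of_int m :: rat) = of_nat (nat p) * (of_int a / of_int b)"
    by (auto simp: in_pZp_def p_eq)
  have "b \<noteq> 0" using b by auto
  with m have "(of_int (m * b) :: rat) = of_int (p * a)" by (simp add: p_eq field_simps)
  then have "m * b = p * a" by (simp only: of_int_eq_iff)
  then have "p dvd m * b" by simp
  with b show "p dvd m" by (simp add: prime_dvd_mult_iff[OF prime_p])
next
  assume "p dvd m"
  then obtain k where "m = p * k" by blast
  then show "in_pZp (nat p) (of_int m)"
    unfolding in_pZp_def using prime_p by (intro exI[of _ k] exI[of _ 1]) (auto simp: p_eq)
qed

lemma lucas_rank_eq: "lucas_rank P Q (nat p) = (LEAST n. n > 0 \<and> p dvd snd ((shiftp ^^ n) (1, 0)))"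
  by (simp add: lucas_rank_def lucas_shiftp in_pZp_of_int_iff)

end

text \<open>Only one half of the kernel condition, \<open>g_one\<close>, is an axiom: it suffices
  for well-definedness and is common to both quotients. The converse differs between
  \<open>K\<close> and its starred image and is left to the two criteria below.\<close>

locale lucas_prime_hom = lucas_prime + B: group B for B :: "'b monoid" +
  fixes g :: "int \<Rightarrow> int \<Rightarrow> 'b"
  assumes g_closed: "\<not> p dvd N a b \<Longrightarrow> g a b \<in> carrier B"
    and g_mult: "\<not> p dvd N a b \<Longrightarrow> \<not> p dvd N c d \<Longrightarrow>
      g (a * c - Q * b * d) (b * c + a * d - P * b * d) = g a b \<otimes>\<^bsub>B\<^esub> g c d"
    and g_surj: "y \<in> carrier B \<Longrightarrow> \<exists>a b. \<not> p dvd N a b \<and> g a b = y"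
    and g_one: "\<not> p dvd N a b \<Longrightarrow> p dvd b \<Longrightarrow> g a b = \<one>\<^bsub>B\<^esub>"
begin

text \<open>Multiplying both pairs by the conjugate of \<open>(c, d)\<close> gives pairs in the kernel.\<close>

lemma g_wd:
  assumes N: "\<not> p dvd N a b" "\<not> p dvd N c d" and eq: "pcls a b = pcls c d"
  shows "g a b = g c d"
proof -
  define c' d' where "c' = c - P * d" and "d' = - d"
  have N': "\<not> p dvd N c' d'" using N by (simp add: c'_def d'_def norm_form_conj)
  have e: "a * d = b * c" using eq pcls_eq_iff N N_nz by blast
  have "b * c' + a * d' - P * b * d' = 0" using e by (simp add: c'_def d'_def algebra_simps)
  then have "g a b \<otimes>\<^bsub>B\<^esub> g c' d' = \<one>\<^bsub>B\<^esub>"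
    using g_mult[OF N(1) N'] g_one[OF N_mult_unit[OF N(1) N']] by simp
  moreover have "d * c' + c * d' - P * d * d' = 0" by (simp add: c'_def d'_def algebra_simps)
  then have "g c d \<otimes>\<^bsub>B\<^esub> g c' d' = \<one>\<^bsub>B\<^esub>"
    using g_mult[OF N(2) N'] g_one[OF N_mult_unit[OF N(2) N']] by simp
  ultimately show ?thesis using N N' g_closed by (metis B.r_cancel)
qed

lemma K_iso_viaI:
  assumes ker: "\<And>a b. \<not> p dvd N a b \<Longrightarrow> g a b = \<one>\<^bsub>B\<^esub> \<Longrightarrow> p dvd b"
  shows "K_iso_via P Q ty B g"
  unfolding K_iso_via_def
proof (rule quot_iso_viaI[where unit = "\<lambda>a b. \<not> p dvd N a b" and
      ?m1.0 = "\<lambda>a b c d. a * c - Q * b * d" and ?m0.0 = "\<lambda>a b c d. b * c + a * d - P * b * d"])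
  show "carrier (K_grp P Q ty) = {pcls a b | a b. \<not> p dvd N a b}"
    by (auto simp: K_grp_def intro: pcls_in_K elim: K_rep)
  show "\<not> p dvd N a b" if "coprime a b" "pcls a b \<in> carrier (K_grp P Q ty)" for a b
    using that coprime_pcls_in_K_iff by (simp add: K_grp_def)
  show "pcls a b \<otimes>\<^bsub>K_grp P Q ty\<^esub> pcls c d = pcls (a * c - Q * b * d) (b * c + a * d - P * b * d)"
    if "\<not> p dvd N a b" "\<not> p dvd N c d" for a b c d
    using pcls_mult[OF that[THEN N_nz]] by (simp add: K_grp_def)
  show "g a b = \<one>\<^bsub>B\<^esub> \<longleftrightarrow> pcls a b \<in> G_sub P Q ty" if "\<not> p dvd N a b" for a b
    using that ker g_one pcls_in_H_iff by blast
qed (use comm_group_K B.is_group subgroup_H_K N_mult_unit g_closed g_mult g_surj g_wd in \<open>blast+\<close>)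

text \<open>\<open>(P, 1)\<close> is the shift of \<open>(1, 0)\<close> and stands for the conjugate
  root; a multiplicative \<open>g\<close> that is trivial on it is constant along shifts, hence
  depends on the starred class only. Conversely a pair in the kernel merely has to reach
  \<open>G(f,p)\<close> after some number of shifts.\<close>

lemma Kstar_iso_viaI:
  assumes g_shift: "g P 1 = \<one>\<^bsub>B\<^esub>"
    and ker: "\<And>a b. \<not> p dvd N a b \<Longrightarrow> g a b = \<one>\<^bsub>B\<^esub> \<Longrightarrow> \<exists>k. p dvd snd ((shiftp ^^ k) (a, b))"
  shows "Kstar_iso_via P Q ty B g"
proof -
  have N1: "\<not> p dvd N P 1" "\<not> p dvd N 0 (- 1)"
    using p_ndvd_Q by (simp_all add: norm_form_def power2_eq_square)
  \<comment> \<open>The product of \<open>(P, 1)\<close> with \<open>(x, y)\<close> is precisely the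
    shifted pair.\<close>
  have shift: "g (P * x - Q * y) x = g x y" if "\<not> p dvd N x y" for x y
    using g_mult[OF N1(1) that] g_shift g_closed[OF that] by (simp add: algebra_simps)
  \<comment> \<open>The pair \<open>(0, - 1)\<close> stands for the root \<open>\<theta>\<close>
    itself; its shift is the scalar pair \<open>(Q, 0)\<close>, on which \<open>g\<close> is
    trivial.\<close>
  have "g 0 (- 1) = g Q 0" using shift[OF N1(2)] by simp
  also have "\<dots> = \<one>\<^bsub>B\<^esub>"
    using prime_p p_ndvd_Q by (intro g_one) (auto simp: norm_form_def prime_dvd_power_iff)
  finally have g01: "g 0 (- 1) = \<one>\<^bsub>B\<^esub>" .
  \<comment> \<open>Multiplication by \<open>(0, - 1)\<close> gives \<open>Q\<close> times the
    backward shift.\<close>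
  have unshift: "g (Q * y) (P * y - x) = g x y" if "\<not> p dvd N x y" for x y
    using g_mult[OF N1(2) that] g01 g_closed[OF that] by (simp add: algebra_simps)
  have wd: "g a b = g c d" if N: "\<not> p dvd N a b" "\<not> p dvd N c d" and eq: "pstar a b = pstar c d" for a b c d
  proof -
    obtain x y where "\<not> p dvd N x y \<and> g x y = g c d" "pcls a b = pcls x y"
      using pstar_eq_induct[OF eq N[THEN N_nz], of "\<lambda>x y. \<not> p dvd N x y \<and> g x y = g c d"]
        N(2) N_shift_unit N_unshift_unit shift unshift by metis
    then show ?thesis using g_wd N by metis
  qed
  show ?thesis
    unfolding Kstar_iso_via_def
  proof (rule quot_iso_viaI[where unit = "\<lambda>a b. \<not> p dvd N a b" and
        ?m1.0 = "\<lambda>a b c d. a * c - Q * b * d" and ?m0.0 = "\<lambda>a b c d. b * c + a * d - P * b * d"])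
    show "carrier (Kstar_grp P Q ty) = {pstar a b | a b. \<not> p dvd N a b}"
      by (auto simp: Kstar_grp_def Kstar_sub_def intro: pcls_in_K elim!: K_rep)
    show "\<not> p dvd N a b" if "coprime a b" "pstar a b \<in> carrier (Kstar_grp P Q ty)" for a b
      using that coprime_pstar_in_Kstar by (simp add: Kstar_grp_def)
    show "pstar a b \<otimes>\<^bsub>Kstar_grp P Q ty\<^esub> pstar c d = pstar (a * c - Q * b * d) (b * c + a * d - P * b * d)"
      if "\<not> p dvd N a b" "\<not> p dvd N c d" for a b c d
      using pstar_mult[OF that[THEN N_nz]] by (simp add: Kstar_grp_def)
    show "g a b = \<one>\<^bsub>B\<^esub> \<longleftrightarrow> pstar a b \<in> Gstar_sub P Q ty" if u: "\<not> p dvd N a b" for a b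
    proof
      assume "g a b = \<one>\<^bsub>B\<^esub>"
      then obtain k c d where cd: "(shiftp ^^ k) (a, b) = (c, d)" "p dvd d"
        using ker[OF u] by (metis prod.collapse)
      with pstar_shiftp_pow[OF u cd(1)] show "pstar a b \<in> Gstar_sub P Q ty"
        unfolding Gstar_sub_def using pcls_in_H_iff by (metis imageI)
    next
      assume "pstar a b \<in> Gstar_sub P Q ty"
      then obtain c d where "\<not> p dvd N c d" "p dvd d" "pstar a b = pstar c d"
        unfolding Gstar_sub_def by (auto elim!: H_rep)
      then show "g a b = \<one>\<^bsub>B\<^esub>" using wd[OF u] g_one by metis
    qed
  qed (use comm_group_Kstar B.is_group subgroup_Gstar_Kstar N_mult_unit g_closed g_mult g_surj wd in \<open>blast+\<close>)
qed

end

section \<open>The unit groups over the finite prime field\<close>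

lemma ring_of_type_algebra_sel [simp]:
  "carrier (ring_of_type_algebra :: 'a::field ring) = UNIV"
  "x \<otimes>\<^bsub>ring_of_type_algebra\<^esub> y = x * (y::'a)"
  "x \<oplus>\<^bsub>ring_of_type_algebra\<^esub> y = x + (y::'a)"
  "\<one>\<^bsub>ring_of_type_algebra\<^esub> = (1::'a)"
  "\<zero>\<^bsub>ring_of_type_algebra\<^esub> = (0::'a)"
  by (simp_all add: ring_of_type_algebra_def)

lemma ring_of_type_algebra_minus [simp]: "\<ominus>\<^bsub>ring_of_type_algebra\<^esub> x = - (x::'a::field)"
proof -
  interpret R: field "ring_of_type_algebra :: 'a ring" by (rule field_from_type_algebra)
  show ?thesis by (rule R.minus_equality) simp_all
qed

lemma ring_of_type_algebra_inv: "x \<noteq> 0 \<Longrightarrow> inv\<^bsub>ring_of_type_algebra\<^esub> x = inverse (x::'a::field)"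
proof -
  interpret R: field "ring_of_type_algebra :: 'a ring" by (rule field_from_type_algebra)
  show "x \<noteq> 0 \<Longrightarrow> ?thesis" by (rule R.comm_inv_char) simp_all
qed

lemma subfield_ring_of_type_algebraI:
  fixes K :: "'a::field set"
  assumes "1 \<in> K" "\<And>x. x \<in> K \<Longrightarrow> - x \<in> K" "\<And>x y. x \<in> K \<Longrightarrow> y \<in> K \<Longrightarrow> x * y \<in> K"
    "\<And>x y. x \<in> K \<Longrightarrow> y \<in> K \<Longrightarrow> x + y \<in> K" "\<And>x. x \<in> K \<Longrightarrow> x \<noteq> 0 \<Longrightarrow> inverse x \<in> K"
  shows "subfield K ring_of_type_algebra"
proof -
  interpret R: field "ring_of_type_algebra :: 'a ring" by (rule field_from_type_algebra)
  show ?thesis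
    using assms by (intro R.subfieldI' R.subringI) (simp_all add: ring_of_type_algebra_inv)
qed

text \<open>A subset of a field type serves as parameter, so that the prime field and its extension
  are handled alike and the group operation is the product of the type.\<close>

definition unit_group :: "'a::field set \<Rightarrow> 'a monoid" where
  "unit_group K = mult_group (ring_of_type_algebra\<lparr>carrier := K\<rparr>)"

lemma unit_group_sel [simp]:
  "carrier (unit_group K) = K - {0}"
  "x \<otimes>\<^bsub>unit_group K\<^esub> y = x * y"
  "\<one>\<^bsub>unit_group K\<^esub> = 1"
  by (simp_all add: unit_group_def)

lemma unit_group_pow [simp]: "x [^]\<^bsub>unit_group K\<^esub> (n::nat) = x ^ n"
  by (induction n) (simp_all add: Group.nat_pow_def mult.commute)

locale finite_subfield =
  fixes K :: "'a::field set"
  assumes subfield: "subfield K ring_of_type_algebra" and fin: "finite K"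
begin

sublocale U: comm_group "unit_group K"
proof -
  interpret R: field "ring_of_type_algebra :: 'a ring" by (rule field_from_type_algebra)
  have "group (unit_group K)"
    unfolding unit_group_def by (rule field.field_mult_group[OF R.subfield_iff(2)[OF subfield]])
  then show "comm_group (unit_group K)"
    by (rule group.group_comm_groupI) simp
qed

lemma finite_units: "finite (carrier (unit_group K))"
  using fin by simp

lemma order_units: "Coset.order (unit_group K) = card K - 1"
proof -
  interpret R: field "ring_of_type_algebra :: 'a ring" by (rule field_from_type_algebra)
  have "0 \<in> K" using subringE(2)[OF subfieldE(1)[OF subfield]] by simp
  then show ?thesis using fin by (simp add: Coset.order_def)
qed

lemma units_generator:
  obtains x where "x \<in> carrier (unit_group K)"
    "carrier (unit_group K) = range (\<lambda>i::nat. x [^]\<^bsub>unit_group K\<^esub> i)"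
proof -
  interpret R: field "ring_of_type_algebra :: 'a ring" by (rule field_from_type_algebra)
  have "\<exists>x \<in> carrier (unit_group K). carrier (unit_group K) =
      {x [^]\<^bsub>ring_of_type_algebra\<lparr>carrier := K\<rparr>\<^esub> i | i::nat. i \<in> UNIV}"
    unfolding unit_group_def
    by (rule field.finite_field_mult_group_has_gen[OF R.subfield_iff(2)[OF subfield]]) (simp add: fin)
  moreover have "x [^]\<^bsub>ring_of_type_algebra\<lparr>carrier := K\<rparr>\<^esub> i = x [^]\<^bsub>unit_group K\<^esub> i" for x and i :: nat
    by (simp add: Group.nat_pow_def unit_group_def)
  ultimately show ?thesis using that by (auto simp: image_def)
qed

lemma units_iso: "unit_group K \<cong> integer_mod_group (card K - 1)"
  using units_generator U.cyclic_iso_integer_mod_group[OF finite_units] order_units by metis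

lemma units_quotient_iso:
  assumes "subgroup M (unit_group K)"
  shows "unit_group K Mod M \<cong> integer_mod_group ((card K - 1) div card M)"
  using units_generator U.cyclic_quotient_iso_integer_mod_group[OF finite_units _ _ assms] order_units
  by metis

lemma mem_generate_iff:
  assumes "x \<in> K" "x \<noteq> 0"
  shows "y \<in> generate (unit_group K) {x} \<longleftrightarrow> (\<exists>k::nat. y = x ^ k)"
  using U.generate_pow_on_finite_carrier[OF finite_units, of x] assms by auto

lemma coset_eq_iff:
  assumes "subgroup M (unit_group K)" "x \<in> K" "x \<noteq> 0"
  shows "M #>\<^bsub>unit_group K\<^esub> x = M \<longleftrightarrow> x \<in> M"
  using assms U.coset_join1 U.coset_join2 by (metis DiffI singletonD unit_group_sel(1))

end

text \<open>Vieta's relations treat distinct and coinciding roots uniformly; the double root is the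
  instance \<open>r1 = r2\<close>.\<close>

locale lucas_roots = lucas_prime P Q p ty for P Q p and ty :: "'p::prime_card itself" +
  fixes r1 r2 :: "'p mod_ring alg_closure"
  assumes root_sum: "r1 + r2 = of_int P" and root_prod: "r1 * r2 = of_int Q"
begin

definition F0 :: "'p mod_ring alg_closure set" where "F0 = range to_ac"
abbreviation "F \<equiv> F0 - {0}"

text \<open>The prime field consists of the images of the natural numbers. Integer pairs therefore
  reach all its elements, and in the double root case an element can be used as a number of
  shifts.\<close>

lemma F0_iff: "x \<in> F0 \<longleftrightarrow> (\<exists>n::nat. x = of_nat n)"
proof
  assume "x \<in> F0"
  then obtain t :: "'p mod_ring" where "x = to_ac t" unfolding F0_def by blast
  moreover obtain n where "t = of_nat n" using surj_of_nat_mod_ring by blast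
  ultimately show "\<exists>n::nat. x = of_nat n" by auto
next
  assume "\<exists>n::nat. x = of_nat n"
  then obtain n where "x = to_ac (of_nat n :: 'p mod_ring)" by auto
  then show "x \<in> F0" by (simp add: F0_def del: to_ac_of_nat)
qed

lemma F0_of_int [simp]: "of_int a \<in> F0"
proof -
  have "to_ac (of_int a :: 'p mod_ring) \<in> F0" by (simp add: F0_def del: to_ac_of_int)
  then show ?thesis by simp
qed

lemma F0_obtain:
  assumes "x \<in> F0"
  obtains a where "x = of_int a"
  using assms F0_iff by (metis of_int_of_nat_eq)

lemma to_ac_in_F0: "to_ac t \<in> F0"
  by (simp add: F0_def)

lemma F0_add: "x \<in> F0 \<Longrightarrow> y \<in> F0 \<Longrightarrow> x + y \<in> F0"
  and F0_mult: "x \<in> F0 \<Longrightarrow> y \<in> F0 \<Longrightarrow> x * y \<in> F0"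
  and F0_diff: "x \<in> F0 \<Longrightarrow> y \<in> F0 \<Longrightarrow> x - y \<in> F0"
proof -
  assume "x \<in> F0" "y \<in> F0"
  then obtain s t where "x = to_ac s" "y = to_ac t" by (auto simp: F0_def)
  then show "x + y \<in> F0" "x * y \<in> F0" "x - y \<in> F0"
    using to_ac_in_F0[of "s + t"] to_ac_in_F0[of "s * t"] to_ac_in_F0[of "s - t"] by simp_all
qed

lemma F0_minus: "x \<in> F0 \<Longrightarrow> - x \<in> F0"
  and F0_inverse: "x \<in> F0 \<Longrightarrow> inverse x \<in> F0"
proof -
  assume "x \<in> F0"
  then obtain s where "x = to_ac s" by (auto simp: F0_def)
  then show "- x \<in> F0" "inverse x \<in> F0"
    using to_ac_in_F0[of "- s"] to_ac_in_F0[of "inverse s"] by simp_all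
qed

lemmas F0_closed = F0_add F0_mult F0_diff F0_minus F0_inverse F0_of_int

lemma F0_power: "x \<in> F0 \<Longrightarrow> x ^ n \<in> F0"
  by (induction n) (use F0_of_int[of 1] F0_mult in auto)

lemma of_int_ac_eq_0_iff: "(of_int a :: 'p mod_ring alg_closure) = 0 \<longleftrightarrow> p dvd a"
proof -
  have "(of_int a :: 'p mod_ring alg_closure) = 0 \<longleftrightarrow> to_ac (of_int a :: 'p mod_ring) = 0" by simp
  then show ?thesis unfolding to_ac_eq_0_iff of_int_eq_0_iff_p_dvd .
qed

lemma card_F0: "card F0 = nat p"
  using card_image[OF inj_to_ac, where 'a1 = "'p mod_ring"] by (simp add: p_eq F0_def)

lemma card_F: "card F = nat p - 1"
  using card_F0 F0_of_int[of 0] by simp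

lemma p_gt_1: "nat p > 1"
  using prime_gt_1_int[OF prime_p] by simp

lemma roots_nz: "r1 \<noteq> 0" "r2 \<noteq> 0"
  using root_prod of_int_ac_eq_0_iff[of Q] p_ndvd_Q by auto

lemma root_sq: "r1 * r1 = of_int P * r1 - of_int Q" "r2 * r2 = of_int P * r2 - of_int Q"
  by (simp_all add: root_sum[symmetric] root_prod[symmetric] algebra_simps)

lemma of_int_N: "of_int (N a b) = (of_int a - of_int b * r1) * (of_int a - of_int b * r2)"
  by (simp add: norm_form_def root_sum[symmetric] root_prod[symmetric] power2_eq_square algebra_simps)

lemma N_unit_iff: "\<not> p dvd N a b \<longleftrightarrow> of_int a - of_int b * r1 \<noteq> 0 \<and> of_int a - of_int b * r2 \<noteq> 0"
  unfolding of_int_ac_eq_0_iff[symmetric] of_int_N by simp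

lemma linear_mult:
  assumes "r = r1 \<or> r = r2"
  shows "of_int (a * c - Q * b * d) - of_int (b * c + a * d - P * b * d) * r =
    (of_int a - of_int b * r) * (of_int c - of_int d * r)"
proof -
  have "(of_int a - of_int b * r) * (of_int c - of_int d * r) =
      of_int a * of_int c - (of_int b * of_int c + of_int a * of_int d) * r + of_int b * of_int d * (r * r)"
    by (simp add: algebra_simps)
  also have "r * r = of_int P * r - of_int Q" using assms root_sq by auto
  finally show ?thesis by (simp add: algebra_simps)
qed

text \<open>As \<open>P - r1 = r2\<close> and \<open>Q = r1 * r2\<close>, a shift multiplies the
  value at one root by the other root.\<close>

lemma shiftp_pow_linear:
  assumes "(shiftp ^^ k) (a, b) = (x, y)"
  shows "of_int x - of_int y * r1 = r2 ^ k * (of_int a - of_int b * r1)"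
    and "of_int x - of_int y * r2 = r1 ^ k * (of_int a - of_int b * r2)"
proof -
  have "of_int x - of_int y * r1 = r2 ^ k * (of_int a - of_int b * r1) \<and>
    of_int x - of_int y * r2 = r1 ^ k * (of_int a - of_int b * r2)"
    using assms
  proof (induction k arbitrary: x y)
    case 0
    then show ?case by simp
  next
    case (Suc k)
    obtain x' y' where xy: "(shiftp ^^ k) (a, b) = (x', y')" by fastforce
    with Suc.prems have *: "x = P * x' - Q * y'" "y = x'" by (auto simp: shiftp_def)
    have "of_int x - of_int y * r1 = r2 * (of_int x' - of_int y' * r1)"
      "of_int x - of_int y * r2 = r1 * (of_int x' - of_int y' * r2)"
      by (simp_all add: * root_sum[symmetric] root_prod[symmetric] algebra_simps)
    with Suc.IH[OF xy] show ?case by simp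
  qed
  then show "of_int x - of_int y * r1 = r2 ^ k * (of_int a - of_int b * r1)"
    "of_int x - of_int y * r2 = r1 ^ k * (of_int a - of_int b * r2)" by auto
qed

lemma subfield_F0: "subfield F0 ring_of_type_algebra"
proof (rule subfield_ring_of_type_algebraI)
  show "1 \<in> F0" using F0_of_int[of 1] by simp
qed (auto intro: F0_closed)

sublocale B: finite_subfield F0
  using subfield_F0 by (intro finite_subfield.intro) (simp_all add: F0_def)

lemma base_field_units: "mult_group base_field = unit_group F0"
  by (simp add: base_field_def unit_group_def F0_def)

end

section \<open>A polynomial that is irreducible modulo \<open>p\<close>\<close>

locale lucas_roots_inert = lucas_roots P Q p ty r1 r2
  for P Q p and ty :: "'p::prime_card itself" and r1 r2 +
  assumes r1_notin: "r1 \<notin> F0"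
begin

text \<open>Linear independence of \<open>1\<close> and \<open>r1\<close> over the prime field:
  otherwise \<open>r1\<close> could be solved for inside it.\<close>

lemma linear_in_F0_iff: "of_int a - of_int b * r1 \<in> F0 \<longleftrightarrow> p dvd b"
proof
  assume *: "of_int a - of_int b * r1 \<in> F0"
  show "p dvd b"
  proof (rule ccontr)
    assume "\<not> p dvd b"
    then have b: "(of_int b :: 'p mod_ring alg_closure) \<noteq> 0" by (simp add: of_int_ac_eq_0_iff)
    have "of_int a - (of_int a - of_int b * r1) \<in> F0" by (rule F0_diff[OF F0_of_int *])
    then have "of_int b * r1 \<in> F0" by simp
    then have "inverse (of_int b) * (of_int b * r1) \<in> F0" by (rule F0_mult[OF F0_inverse[OF F0_of_int]])
    then show False using b r1_notin by (simp add: mult.assoc[symmetric])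
  qed
next
  assume "p dvd b"
  then have "(of_int b :: 'p mod_ring alg_closure) = 0" by (simp add: of_int_ac_eq_0_iff)
  then show "of_int a - of_int b * r1 \<in> F0" by simp
qed

text \<open>The field generated by \<open>r1\<close>, written through integer pairs so that
  surjectivity of the explicit maps is immediate.\<close>

definition E where "E = {of_int a - of_int b * r1 | a b. True}"

lemma E_I [intro]: "of_int a - of_int b * r1 \<in> E"
  by (auto simp: E_def)

lemma E_memI: "x = of_int a - of_int b * r1 \<Longrightarrow> x \<in> E"
  by auto

lemma F0_subset_E: "F0 \<subseteq> E"
proof
  fix x assume "x \<in> F0"
  then obtain a where "x = of_int a" by (rule F0_obtain)
  then show "x \<in> E" by (intro E_memI[of _ a 0]) simp
qed

text \<open>The conjugate equals \<open>(a - P * b) + b * r1\<close>. Were it zero, independence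
  would make \<open>p\<close> divide \<open>b\<close>, and then the element would agree with its
  conjugate.\<close>

lemma E_nonzero_unit:
  assumes "of_int a - of_int b * r1 \<noteq> 0"
  shows "\<not> p dvd N a b"
proof -
  have "of_int a - of_int b * r2 \<noteq> 0"
  proof
    assume z: "of_int a - of_int b * r2 = 0"
    have r2: "r2 = of_int P - r1" by (simp add: root_sum[symmetric])
    have "of_int (a - P * b) - of_int (- b) * r1 = 0" using z by (simp add: r2 algebra_simps)
    then have "of_int (a - P * b) - of_int (- b) * r1 \<in> F0" by (metis F0_of_int of_int_0)
    then have "p dvd - b" unfolding linear_in_F0_iff .
    then have "(of_int b :: 'p mod_ring alg_closure) = 0" by (simp add: of_int_ac_eq_0_iff)
    with z assms show False by simp
  qed
  with assms show ?thesis by (simp add: N_unit_iff)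
qed

lemma subfield_E: "subfield E ring_of_type_algebra"
proof (rule subfield_ring_of_type_algebraI)
  show "1 \<in> E" by (rule E_memI[of _ 1 0]) simp
next
  fix x assume "x \<in> E"
  then obtain a b where "x = of_int a - of_int b * r1" by (auto simp: E_def)
  then show "- x \<in> E" by (intro E_memI[of _ "- a" "- b"]) simp
next
  fix x y assume "x \<in> E" "y \<in> E"
  then obtain a b c d where *: "x = of_int a - of_int b * r1" "y = of_int c - of_int d * r1" by (auto simp: E_def)
  show "x * y \<in> E" unfolding * linear_mult[OF disjI1[OF refl], symmetric] by (rule E_I)
  show "x + y \<in> E" unfolding * by (intro E_memI[of _ "a + c" "b + d"]) (simp add: algebra_simps)
next
  fix x assume "x \<in> E" "x \<noteq> 0"
  then obtain a b where x: "x = of_int a - of_int b * r1" by (auto simp: E_def)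
  \<comment> \<open>The inverse is the conjugate over the norm; the inverse of the norm lies in the
    prime field and so is the image of an integer \<open>m\<close>.\<close>
  have n: "of_int (N a b) \<noteq> (0 :: 'p mod_ring alg_closure)"
    using E_nonzero_unit \<open>x \<noteq> 0\<close> by (simp add: x of_int_ac_eq_0_iff)
  have "inverse (of_int (N a b)) \<in> F0" by (intro F0_inverse F0_of_int)
  then obtain m where m: "inverse (of_int (N a b)) = (of_int m :: 'p mod_ring alg_closure)"
    by (rule F0_obtain)
  have "x * (of_int m * (of_int a - of_int b * r2)) = of_int m * of_int (N a b)"
    by (simp add: of_int_N x)
  also have "\<dots> = 1" unfolding m[symmetric] using n by simp
  finally have "inverse x = of_int m * (of_int a - of_int b * r2)" by (rule inverse_unique)
  also have "r2 = of_int P - r1" by (simp add: root_sum[symmetric])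
  finally have "inverse x = of_int (m * (a - b * P)) - of_int (- (m * b)) * r1"
    by (simp add: algebra_simps)
  then show "inverse x \<in> E" by (rule E_memI)
qed

text \<open>A plane over the prime field: injectivity of the coordinates is again the independence
  of \<open>1\<close> and \<open>r1\<close>.\<close>

lemma card_E: "finite E" "card E = (nat p)\<^sup>2"
proof -
  define f where "f = (\<lambda>(s :: 'p mod_ring, t :: 'p mod_ring). to_ac s - to_ac t * r1)"
  have E: "E = f ` UNIV"
  proof (intro equalityI subsetI)
    fix x assume "x \<in> E"
    then obtain a b where "x = of_int a - of_int b * r1" by (auto simp: E_def)
    then have "x = f (of_int a, of_int b)" by (simp add: f_def)
    then show "x \<in> f ` UNIV" by blast
  next
    fix x assume "x \<in> f ` UNIV"
    then obtain s t where "x = to_ac s - to_ac t * r1" by (auto simp: f_def)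
    moreover obtain a b where "to_ac s = of_int a" "to_ac t = of_int b"
      using F0_obtain[OF to_ac_in_F0[of s]] F0_obtain[OF to_ac_in_F0[of t]] by metis
    ultimately show "x \<in> E" by auto
  qed
  moreover have "inj f"
  proof (rule injI, clarsimp simp: f_def)
    fix s t s' t' :: "'p mod_ring"
    assume "to_ac s - to_ac t * r1 = to_ac s' - to_ac t' * r1"
    then have *: "to_ac (s - s') = to_ac (t - t') * r1" by (simp add: algebra_simps)
    have "t = t'"
    proof (rule ccontr)
      assume "t \<noteq> t'"
      then have "to_ac (t - t') \<noteq> 0" by (simp del: to_ac_diff)
      then have "r1 = to_ac ((s - s') / (t - t'))" unfolding to_ac_divide * by simp
      then have "r1 \<in> F0" using to_ac_in_F0 by metis
      then show False using r1_notin by blast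
    qed
    with * show "s = s' \<and> t = t'" by simp
  qed
  ultimately show "finite E" "card E = (nat p)\<^sup>2"
    by (simp_all add: card_image p_eq power2_eq_square card_cartesian_product flip: UNIV_Times_UNIV)
qed

sublocale U: finite_subfield E
  using subfield_E card_E(1) by (rule finite_subfield.intro)

lemma adjoin_units: "mult_group (adjoin r1) = unit_group E"
proof -
  interpret R: field "ring_of_type_algebra :: 'p mod_ring alg_closure ring" by (rule field_from_type_algebra)
  have "generate_field ring_of_type_algebra (insert r1 F0) = E"
  proof
    show "generate_field ring_of_type_algebra (insert r1 F0) \<subseteq> E"
    proof (rule R.generate_field_min_subfield1[OF _ subfield_E])
      have "r1 \<in> E" by (rule E_memI[of _ 0 "- 1"]) simp
      then show "insert r1 F0 \<subseteq> E" using F0_subset_E by blast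
    qed simp
    show "E \<subseteq> generate_field ring_of_type_algebra (insert r1 F0)"
    proof
      fix x assume "x \<in> E"
      then obtain a b where x: "x = of_int a + of_int (- b) * r1" by (auto simp: E_def)
      let ?G = "generate_field ring_of_type_algebra (insert r1 F0)"
      have "of_int a \<in> ?G" "of_int (- b) \<in> ?G" "r1 \<in> ?G"
        by (auto intro!: generate_field.incl simp del: of_int_minus)
      then show "x \<in> ?G" unfolding x
        using generate_field.eng_add[of _ ring_of_type_algebra] generate_field.eng_mult[of _ ring_of_type_algebra]
        by (metis ring_of_type_algebra_sel(2,3))
    qed
  qed
  then show ?thesis by (simp add: adjoin_def unit_group_def F0_def)
qed

lemma subgroup_F: "subgroup F (unit_group E)"
proof (rule U.U.subgroupI)
  show "F \<subseteq> carrier (unit_group E)" using F0_subset_E by auto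
  have "1 \<in> F" using F0_of_int[of 1] by simp
  then show "F \<noteq> {}" by blast
next
  fix x assume x: "x \<in> F"
  then have "inverse x \<in> F" using F0_closed by auto
  moreover have "inv\<^bsub>unit_group E\<^esub> x = inverse x"
    using x \<open>inverse x \<in> F\<close> F0_subset_E by (intro U.U.inv_equality) auto
  ultimately show "inv\<^bsub>unit_group E\<^esub> x \<in> F" by simp
next
  fix x y assume "x \<in> F" "y \<in> F"
  then show "x \<otimes>\<^bsub>unit_group E\<^esub> y \<in> F" using F0_closed by auto
qed

text \<open>Any subgroup \<open>M\<close> above the scalars is allowed, so \<open>M = F\<close>
  gives the map on \<open>K\<close> and \<open>M = NN\<close> the one on its starred image.\<close>

lemma quotient_hom:
  assumes M: "subgroup M (unit_group E)" and FM: "F \<subseteq> M"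
  shows "lucas_prime_hom TYPE('p) P Q p (unit_group E Mod M)
    (\<lambda>w1 w0. M #>\<^bsub>unit_group E\<^esub> (of_int w1 - of_int w0 * r1))"
proof -
  interpret M: normal M "unit_group E" using M by (rule U.U.subgroup_imp_normal)
  interpret B: group "unit_group E Mod M" by (rule M.factorgroup_is_group)
  have mem: "of_int a - of_int b * r1 \<in> carrier (unit_group E)" if "\<not> p dvd N a b" for a b
    using that by (auto simp: N_unit_iff)
  show ?thesis
  proof (unfold_locales)
    fix a b assume "\<not> p dvd N a b"
    then show "M #>\<^bsub>unit_group E\<^esub> (of_int a - of_int b * r1) \<in> carrier (unit_group E Mod M)"
      unfolding carrier_FactGroup using mem by blast
  next
    fix a b c d assume "\<not> p dvd N a b" "\<not> p dvd N c d"
    then show "M #>\<^bsub>unit_group E\<^esub> (of_int (a * c - Q * b * d) - of_int (b * c + a * d - P * b * d) * r1) =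
      (M #>\<^bsub>unit_group E\<^esub> (of_int a - of_int b * r1)) \<otimes>\<^bsub>unit_group E Mod M\<^esub>
      (M #>\<^bsub>unit_group E\<^esub> (of_int c - of_int d * r1))"
      using M.rcos_sum[OF mem mem] by (subst linear_mult) simp_all
  next
    fix y assume "y \<in> carrier (unit_group E Mod M)"
    then obtain z where z: "z \<in> E" "z \<noteq> 0" "y = M #>\<^bsub>unit_group E\<^esub> z" by (auto simp: carrier_FactGroup)
    then obtain a b where "z = of_int a - of_int b * r1" unfolding E_def by blast
    with z show "\<exists>a b. \<not> p dvd N a b \<and> M #>\<^bsub>unit_group E\<^esub> (of_int a - of_int b * r1) = y"
      using E_nonzero_unit by blast
  next
    fix a b assume N: "\<not> p dvd N a b" and "p dvd b"
    then have "of_int a - of_int b * r1 \<in> F" unfolding Diff_iff linear_in_F0_iff by (simp add: N_unit_iff)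
    then have "of_int a - of_int b * r1 \<in> M" using FM by blast
    then show "M #>\<^bsub>unit_group E\<^esub> (of_int a - of_int b * r1) = \<one>\<^bsub>unit_group E Mod M\<^esub>"
      using U.coset_eq_iff[OF M] mem[OF N] by simp
  qed
qed

abbreviation "NN \<equiv> F <#>\<^bsub>unit_group E\<^esub> generate (unit_group E) {r1}"

lemma r1_in_E: "r1 \<in> E"
  by (rule E_memI[of _ 0 "- 1"]) simp

text \<open>By finiteness nonnegative exponents suffice, which is what allows an exponent to be used
  as a number of shifts.\<close>

lemma mem_NN_iff: "x \<in> NN \<longleftrightarrow> (\<exists>c \<in> F. \<exists>k::nat. x = c * r1 ^ k)"
proof -
  have "x \<in> NN \<longleftrightarrow> (\<exists>c \<in> F. \<exists>y \<in> generate (unit_group E) {r1}. x = c * y)"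
    unfolding set_mult_def by simp
  then show ?thesis using U.mem_generate_iff[OF r1_in_E roots_nz(1)] by metis
qed

lemma subgroup_NN: "subgroup NN (unit_group E)"
  by (intro U.U.mult_subgroups subgroup_F U.U.generate_is_subgroup) (use r1_in_E roots_nz in auto)

lemma F_subset_NN: "F \<subseteq> NN"
proof
  fix x assume "x \<in> F"
  then have "\<exists>k::nat. x = x * r1 ^ k" by (intro exI[of _ 0]) simp
  with \<open>x \<in> F\<close> show "x \<in> NN" unfolding mem_NN_iff by blast
qed

lemma inert_K_iso: "K_iso_via P Q ty (unit_group E Mod F) (\<lambda>w1 w0. F #>\<^bsub>unit_group E\<^esub> (of_int w1 - of_int w0 * r1))"
proof -
  interpret h: lucas_prime_hom P Q p ty "unit_group E Mod F" "\<lambda>w1 w0. F #>\<^bsub>unit_group E\<^esub> (of_int w1 - of_int w0 * r1)"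
    by (rule quotient_hom[OF subgroup_F]) simp
  show ?thesis
  proof (rule h.K_iso_viaI)
    fix a b assume "\<not> p dvd N a b" "F #>\<^bsub>unit_group E\<^esub> (of_int a - of_int b * r1) = \<one>\<^bsub>unit_group E Mod F\<^esub>"
    then have "of_int a - of_int b * r1 \<in> F"
      using U.coset_eq_iff[OF subgroup_F E_I] by (simp add: N_unit_iff)
    then show "p dvd b" using linear_in_F0_iff by blast
  qed
qed

lemma inert_Kstar_iso: "Kstar_iso_via P Q ty (unit_group E Mod NN) (\<lambda>w1 w0. NN #>\<^bsub>unit_group E\<^esub> (of_int w1 - of_int w0 * r1))"
proof -
  interpret h: lucas_prime_hom P Q p ty "unit_group E Mod NN" "\<lambda>w1 w0. NN #>\<^bsub>unit_group E\<^esub> (of_int w1 - of_int w0 * r1)"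
    by (rule quotient_hom[OF subgroup_NN F_subset_NN])
  show ?thesis
  proof (rule h.Kstar_iso_viaI)
    have "of_int Q \<in> F" using p_ndvd_Q by (simp add: of_int_ac_eq_0_iff)
    then have Q: "of_int Q \<in> NN" by (rule subsetD[OF F_subset_NN])
    have r1: "r1 \<in> NN" unfolding mem_NN_iff using F0_of_int[of 1] by (intro bexI[of _ 1] exI[of _ 1]) simp_all
    have r2E: "r2 \<in> E" by (rule E_memI[of _ P 1]) (simp add: root_sum[symmetric])
    \<comment> \<open>The shift multiplies by \<open>r2\<close>, but \<open>NN\<close> is generated
      by \<open>r1\<close>; modulo the scalar \<open>Q\<close> the two are inverse to each
      other.\<close>
    have "r2 = of_int Q \<otimes>\<^bsub>unit_group E\<^esub> inv\<^bsub>unit_group E\<^esub> r1"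
      using U.U.inv_solve_right[of r2 "of_int Q" r1] r1_in_E r2E roots_nz root_prod
        subgroup.mem_carrier[OF subgroup_NN Q]
      by (simp add: mult.commute)
    also have "\<dots> \<in> NN"
      by (intro subgroup.m_closed[OF subgroup_NN] subgroup.m_inv_closed[OF subgroup_NN] Q r1)
    finally have "r2 \<in> NN" .
    moreover have "of_int P - of_int 1 * r1 = r2" by (simp add: root_sum[symmetric])
    ultimately show "NN #>\<^bsub>unit_group E\<^esub> (of_int P - of_int 1 * r1) = \<one>\<^bsub>unit_group E Mod NN\<^esub>"
      using U.coset_eq_iff[OF subgroup_NN r2E] roots_nz by simp
  next
    fix a b assume "\<not> p dvd N a b" "NN #>\<^bsub>unit_group E\<^esub> (of_int a - of_int b * r1) = \<one>\<^bsub>unit_group E Mod NN\<^esub>"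
    then have "of_int a - of_int b * r1 \<in> NN"
      using U.coset_eq_iff[OF subgroup_NN E_I] by (simp add: N_unit_iff)
    then obtain c k where c: "c \<in> F" "of_int a - of_int b * r1 = c * r1 ^ k" unfolding mem_NN_iff by blast
    obtain x y where xy: "(shiftp ^^ k) (a, b) = (x, y)" by fastforce
    \<comment> \<open>After \<open>k\<close> shifts the factor \<open>r2 ^ k\<close> turns
      \<open>c * r1 ^ k\<close> into the scalar \<open>c * Q ^ k\<close>.\<close>
    have "of_int x - of_int y * r1 = c * (r1 * r2) ^ k"
      using shiftp_pow_linear(1)[OF xy] c by (simp add: power_mult_distrib mult_ac)
    also have "\<dots> \<in> F0" unfolding root_prod using c(1) by (intro F0_mult F0_power F0_of_int) blast
    finally have "p dvd y" by (simp only: linear_in_F0_iff)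
    then show "\<exists>k. p dvd snd ((shiftp ^^ k) (a, b))" using xy by (metis snd_conv)
  qed
qed

text \<open>The pair of Lucas numbers at \<open>n\<close> has the value \<open>r2 ^ n\<close>, and
  \<open>r1 ^ n * r2 ^ n\<close> is a scalar, so both roots have the same order modulo
  scalars.\<close>

lemma inert_rank: "lucas_rank P Q (nat p) = (LEAST n. n > 0 \<and> r1 ^ n \<in> F)"
proof -
  have "p dvd snd ((shiftp ^^ n) (1, 0)) \<longleftrightarrow> r1 ^ n \<in> F" for n
  proof -
    obtain x y where xy: "(shiftp ^^ n) (1, 0) = (x, y)" by fastforce
    have "p dvd y \<longleftrightarrow> r2 ^ n \<in> F0"
      using shiftp_pow_linear(1)[OF xy] linear_in_F0_iff[of x y] by simp
    also have "\<dots> \<longleftrightarrow> r1 ^ n \<in> F0"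
    proof -
      have *: "r1 ^ n * r2 ^ n \<in> F0" unfolding power_mult_distrib[symmetric] root_prod by (intro F0_power F0_of_int)
      have "r1 ^ n = r1 ^ n * r2 ^ n * inverse (r2 ^ n)" "r2 ^ n = r1 ^ n * r2 ^ n * inverse (r1 ^ n)"
        using roots_nz by (simp_all add: field_simps)
      then show ?thesis using * F0_mult F0_inverse by metis
    qed
    finally show ?thesis using roots_nz xy by simp
  qed
  then show ?thesis by (simp add: lucas_rank_eq)
qed

lemma card_NN: "card NN = (nat p - 1) * lucas_rank P Q (nat p)"
  using U.U.card_subgroup_mult_generate[OF U.finite_units _ subgroup_F, of r1] r1_in_E roots_nz
  by (simp add: card_F inert_rank)

lemma square_minus_1: "(nat p)\<^sup>2 - 1 = (nat p - 1) * (nat p + 1)"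
  by (simp add: power2_eq_square algebra_simps)

lemma inert_quotient: "unit_group E Mod F \<cong> integer_mod_group (nat p + 1)"
proof -
  have "(nat p - 1) * (nat p + 1) div (nat p - 1) = nat p + 1"
    using p_gt_1 by (intro nonzero_mult_div_cancel_left) simp
  then show ?thesis using U.units_quotient_iso[OF subgroup_F] unfolding card_E card_F square_minus_1 by metis
qed

text \<open>Lagrange for \<open>NN\<close> in a group of order \<open>(p - 1) * (p + 1)\<close>,
  with the factor \<open>p - 1\<close> of the scalars cancelled. The division in the order of the
  starred quotient is thus exact.\<close>

lemma inert_rank_dvd: "lucas_rank P Q (nat p) dvd nat p + 1"
proof -
  have "card NN dvd Coset.order (unit_group E)"
    using U.U.lagrange[OF subgroup_NN] by (metis dvd_triv_right)
  then have "(nat p - 1) * lucas_rank P Q (nat p) dvd (nat p - 1) * (nat p + 1)"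
    unfolding card_NN U.order_units card_E square_minus_1 .
  moreover have "0 < nat p - 1" using p_gt_1 by simp
  ultimately show ?thesis by (simp only: nat_mult_dvd_cancel1)
qed

lemma inert_star_quotient: "unit_group E Mod NN \<cong> integer_mod_group ((nat p + 1) div lucas_rank P Q (nat p))"
proof -
  have "(nat p - 1) * (nat p + 1) div ((nat p - 1) * lucas_rank P Q (nat p)) = (nat p + 1) div lucas_rank P Q (nat p)"
    using p_gt_1 by (intro div_mult_mult1) simp
  then show ?thesis using U.units_quotient_iso[OF subgroup_NN] unfolding card_E card_NN square_minus_1 by metis
qed

end

section \<open>Roots in the prime field\<close>

locale lucas_roots_split = lucas_roots P Q p ty r1 r2
  for P Q p and ty :: "'p::prime_card itself" and r1 r2 +
  assumes r1_in: "r1 \<in> F0" and r2_in: "r2 \<in> F0"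
begin

lemma linear_in_F0: "of_int a - of_int b * r1 \<in> F0" "of_int a - of_int b * r2 \<in> F0"
  by (intro F0_closed r1_in r2_in)+

lemma ratio_in: "(of_int a - of_int b * r1) * inverse (of_int a - of_int b * r2) \<in> carrier (unit_group F0)"
  if "\<not> p dvd N a b"
  using that F0_mult[OF linear_in_F0(1) F0_inverse[OF linear_in_F0(2)]] by (simp add: N_unit_iff)

end

section \<open>Two distinct roots in the prime field\<close>

locale lucas_roots_distinct = lucas_roots_split P Q p ty r1 r2
  for P Q p and ty :: "'p::prime_card itself" and r1 r2 +
  assumes r1_neq: "r1 \<noteq> r2"
begin

lemma ratio_hom: "lucas_prime_hom TYPE('p) P Q p (unit_group F0)
    (\<lambda>w1 w0. (of_int w1 - of_int w0 * r1) * inverse (of_int w1 - of_int w0 * r2))"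
proof unfold_locales
  fix a b assume "\<not> p dvd N a b"
  then show "(of_int a - of_int b * r1) * inverse (of_int a - of_int b * r2) \<in> carrier (unit_group F0)"
    by (rule ratio_in)
next
  fix a b c d
  show "(of_int (a * c - Q * b * d) - of_int (b * c + a * d - P * b * d) * r1) *
      inverse (of_int (a * c - Q * b * d) - of_int (b * c + a * d - P * b * d) * r2) =
      (of_int a - of_int b * r1) * inverse (of_int a - of_int b * r2) \<otimes>\<^bsub>unit_group F0\<^esub>
      ((of_int c - of_int d * r1) * inverse (of_int c - of_int d * r2))"
    unfolding linear_mult[OF disjI1[OF refl]] linear_mult[OF disjI2[OF refl]]
    by (simp add: mult_ac)
next
  fix y assume "y \<in> carrier (unit_group F0)"
  then have y: "y \<in> F0" "y \<noteq> 0" by auto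
  \<comment> \<open>The preimage of \<open>y\<close> solves a linear system: the values at
    \<open>r1\<close> and \<open>r2\<close> are prescribed as \<open>y * (r1 - r2)\<close> and
    \<open>r1 - r2\<close>, whence \<open>b = 1 - y\<close> and
    \<open>a = r1 - y * r2\<close>.\<close>
  have "r1 - y * r2 \<in> F0" by (intro F0_diff F0_mult y r1_in r2_in)
  then obtain a where a: "r1 - y * r2 = of_int a" by (rule F0_obtain)
  have "1 - y \<in> F0" using F0_diff[OF F0_of_int[of 1] y(1)] by simp
  then obtain b where b: "1 - y = of_int b" by (rule F0_obtain)
  have "of_int a - of_int b * r1 = y * (r1 - r2)" "of_int a - of_int b * r2 = r1 - r2"
    by (simp_all add: a[symmetric] b[symmetric] algebra_simps)
  then show "\<exists>a b. \<not> p dvd N a b \<and> (of_int a - of_int b * r1) * inverse (of_int a - of_int b * r2) = y"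
    using y r1_neq by (intro exI[of _ a] exI[of _ b]) (simp add: N_unit_iff)
next
  fix a b assume "\<not> p dvd N a b" "p dvd b"
  moreover from this have "of_int b = (0 :: 'p mod_ring alg_closure)" by (simp add: of_int_ac_eq_0_iff)
  ultimately show "(of_int a - of_int b * r1) * inverse (of_int a - of_int b * r2) = \<one>\<^bsub>unit_group F0\<^esub>"
    by (simp add: N_unit_iff)
qed

lemma ratio_eq_1_iff:
  assumes "\<not> p dvd N a b"
  shows "(of_int a - of_int b * r1) * inverse (of_int a - of_int b * r2) = 1 \<longleftrightarrow> p dvd b"
proof -
  have "(of_int a - of_int b * r1) * inverse (of_int a - of_int b * r2) = 1 \<longleftrightarrow>
      of_int a - of_int b * r1 = of_int a - of_int b * r2"
    using assms by (simp add: N_unit_iff field_simps)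
  also have "\<dots> \<longleftrightarrow> of_int b = (0 :: 'p mod_ring alg_closure)" using r1_neq by simp
  finally show ?thesis by (simp add: of_int_ac_eq_0_iff)
qed

abbreviation "q \<equiv> r1 * inverse r2"
abbreviation "QQ \<equiv> generate (unit_group F0) {q}"

lemma q_in: "q \<in> F0" "q \<noteq> 0"
  using roots_nz by (auto intro: F0_closed r1_in r2_in)

lemma subgroup_QQ: "subgroup QQ (unit_group F0)"
  by (rule B.U.generate_is_subgroup) (use q_in in auto)

lemma quotient_ratio_hom: "lucas_prime_hom TYPE('p) P Q p (unit_group F0 Mod QQ)
    (\<lambda>w1 w0. QQ #>\<^bsub>unit_group F0\<^esub> ((of_int w1 - of_int w0 * r1) * inverse (of_int w1 - of_int w0 * r2)))"
proof -
  interpret h: lucas_prime_hom P Q p ty "unit_group F0"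
    "\<lambda>w1 w0. (of_int w1 - of_int w0 * r1) * inverse (of_int w1 - of_int w0 * r2)"
    by (rule ratio_hom)
  interpret M: normal QQ "unit_group F0" using subgroup_QQ by (rule B.U.subgroup_imp_normal)
  interpret B: group "unit_group F0 Mod QQ" by (rule M.factorgroup_is_group)
  show ?thesis
  proof unfold_locales
    fix a b assume "\<not> p dvd N a b"
    then show "QQ #>\<^bsub>unit_group F0\<^esub> ((of_int a - of_int b * r1) * inverse (of_int a - of_int b * r2))
        \<in> carrier (unit_group F0 Mod QQ)"
      unfolding carrier_FactGroup by (intro imageI ratio_in)
  next
    fix a b c d assume N: "\<not> p dvd N a b" "\<not> p dvd N c d"
    show "QQ #>\<^bsub>unit_group F0\<^esub> ((of_int (a * c - Q * b * d) - of_int (b * c + a * d - P * b * d) * r1) *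
        inverse (of_int (a * c - Q * b * d) - of_int (b * c + a * d - P * b * d) * r2)) =
      (QQ #>\<^bsub>unit_group F0\<^esub> ((of_int a - of_int b * r1) * inverse (of_int a - of_int b * r2)))
      \<otimes>\<^bsub>unit_group F0 Mod QQ\<^esub>
      (QQ #>\<^bsub>unit_group F0\<^esub> ((of_int c - of_int d * r1) * inverse (of_int c - of_int d * r2)))"
      unfolding mult_FactGroup h.g_mult[OF N]
      by (rule M.rcos_sum[OF ratio_in[OF N(1)] ratio_in[OF N(2)], symmetric])
  next
    fix y assume "y \<in> carrier (unit_group F0 Mod QQ)"
    then obtain z where z: "z \<in> carrier (unit_group F0)" "y = QQ #>\<^bsub>unit_group F0\<^esub> z"
      unfolding carrier_FactGroup by blast
    from h.g_surj[OF z(1)] z(2)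
    show "\<exists>a b. \<not> p dvd N a b \<and>
        QQ #>\<^bsub>unit_group F0\<^esub> ((of_int a - of_int b * r1) * inverse (of_int a - of_int b * r2)) = y"
      by metis
  next
    fix a b assume N: "\<not> p dvd N a b" "p dvd b"
    show "QQ #>\<^bsub>unit_group F0\<^esub> ((of_int a - of_int b * r1) * inverse (of_int a - of_int b * r2)) =
        \<one>\<^bsub>unit_group F0 Mod QQ\<^esub>"
      unfolding h.g_one[OF N] one_FactGroup
      by (rule B.U.coset_join2[OF B.U.one_closed subgroup_QQ M.one_closed])
  qed
qed

lemma split_K_iso: "K_iso_via P Q ty (unit_group F0)
    (\<lambda>w1 w0. (of_int w1 - of_int w0 * r1) * inverse (of_int w1 - of_int w0 * r2))"
proof -
  interpret h: lucas_prime_hom P Q p ty "unit_group F0"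
    "\<lambda>w1 w0. (of_int w1 - of_int w0 * r1) * inverse (of_int w1 - of_int w0 * r2)"
    by (rule ratio_hom)
  show ?thesis by (rule h.K_iso_viaI) (simp add: ratio_eq_1_iff)
qed

lemma split_Kstar_iso: "Kstar_iso_via P Q ty (unit_group F0 Mod QQ)
    (\<lambda>w1 w0. QQ #>\<^bsub>unit_group F0\<^esub> ((of_int w1 - of_int w0 * r1) * inverse (of_int w1 - of_int w0 * r2)))"
proof -
  interpret h: lucas_prime_hom P Q p ty "unit_group F0 Mod QQ"
    "\<lambda>w1 w0. QQ #>\<^bsub>unit_group F0\<^esub> ((of_int w1 - of_int w0 * r1) * inverse (of_int w1 - of_int w0 * r2))"
    by (rule quotient_ratio_hom)
  have coset: "QQ #>\<^bsub>unit_group F0\<^esub> ((of_int a - of_int b * r1) * inverse (of_int a - of_int b * r2)) =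
      \<one>\<^bsub>unit_group F0 Mod QQ\<^esub> \<longleftrightarrow> (of_int a - of_int b * r1) * inverse (of_int a - of_int b * r2) \<in> QQ"
    if "\<not> p dvd N a b" for a b
    unfolding one_FactGroup by (rule B.coset_eq_iff[OF subgroup_QQ]) (use ratio_in[OF that] in auto)
  show ?thesis
  proof (rule h.Kstar_iso_viaI)
    have NP: "\<not> p dvd N P 1" using p_ndvd_Q by (simp add: norm_form_def power2_eq_square)
    \<comment> \<open>The pair \<open>(P, 1)\<close> has values \<open>r2\<close> and
      \<open>r1\<close> at the two roots, so its ratio is the inverse of \<open>q\<close>.\<close>
    have "inv\<^bsub>unit_group F0\<^esub> q = inverse q"
      by (rule B.U.inv_equality)
        (use left_inverse[OF q_in(2)] nonzero_imp_inverse_nonzero[OF q_in(2)] F0_inverse[OF q_in(1)] q_in in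
          \<open>simp_all only: unit_group_sel Diff_iff singleton_iff simp_thms\<close>)
    moreover have "q \<in> QQ" by (rule generate.incl) simp
    ultimately have "inverse q \<in> QQ" using subgroup.m_inv_closed[OF subgroup_QQ] by metis
    moreover have "of_int P - of_int 1 * r1 = r2" "of_int P - of_int 1 * r2 = r1"
      by (simp_all add: root_sum[symmetric])
    ultimately show "QQ #>\<^bsub>unit_group F0\<^esub> ((of_int P - of_int 1 * r1) * inverse (of_int P - of_int 1 * r2)) =
        \<one>\<^bsub>unit_group F0 Mod QQ\<^esub>"
      unfolding coset[OF NP] by (simp add: mult.commute)
  next
    fix a b assume Nab: "\<not> p dvd N a b" and "QQ #>\<^bsub>unit_group F0\<^esub>
        ((of_int a - of_int b * r1) * inverse (of_int a - of_int b * r2)) = \<one>\<^bsub>unit_group F0 Mod QQ\<^esub>"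
    then have "(of_int a - of_int b * r1) * inverse (of_int a - of_int b * r2) \<in> QQ" using coset by simp
    then obtain k :: nat where k: "(of_int a - of_int b * r1) * inverse (of_int a - of_int b * r2) = q ^ k"
      using B.mem_generate_iff[OF q_in] by blast
    obtain x y where xy: "(shiftp ^^ k) (a, b) = (x, y)" by fastforce
    have Nxy: "\<not> p dvd N x y" using pstar_shiftp_pow[OF Nab xy] by simp
    \<comment> \<open>Each shift divides the ratio by \<open>q\<close>, so \<open>k\<close> shifts
      bring \<open>q ^ k\<close> to 1.\<close>
    have "(of_int x - of_int y * r1) * inverse (of_int x - of_int y * r2) =
        r2 ^ k * inverse (r1 ^ k) * ((of_int a - of_int b * r1) * inverse (of_int a - of_int b * r2))"
      unfolding shiftp_pow_linear[OF xy] by (simp add: mult_ac)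
    also have "\<dots> = 1" unfolding k using roots_nz by (simp add: power_mult_distrib power_inverse field_simps)
    finally have "p dvd y" using ratio_eq_1_iff[OF Nxy] by simp
    then show "\<exists>k. p dvd snd ((shiftp ^^ k) (a, b))" using xy by (metis snd_conv)
  qed
qed

text \<open>The ratio of the Lucas pair at \<open>n\<close> is the inverse of \<open>q ^ n\<close>.
  Membership in \<open>{1}\<close> is the form in which the counting lemma for \<open>F\<close>
  times a cyclic subgroup applies, with \<open>F\<close> trivial.\<close>

lemma split_rank: "lucas_rank P Q (nat p) = (LEAST n. n > 0 \<and> q ^ n \<in> {1})"
proof -
  have "p dvd snd ((shiftp ^^ n) (1, 0)) \<longleftrightarrow> q ^ n \<in> {1}" for n
  proof -
    obtain x y where xy: "(shiftp ^^ n) (1, 0) = (x, y)" by fastforce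
    have N1: "\<not> p dvd N 1 0" using prime_p by (auto simp: norm_form_def)
    have Nxy: "\<not> p dvd N x y" using pstar_shiftp_pow[OF N1 xy] by simp
    have "p dvd y \<longleftrightarrow> r2 ^ n * inverse (r1 ^ n) = 1"
      using ratio_eq_1_iff[OF Nxy] unfolding shiftp_pow_linear[OF xy] by simp
    also have "\<dots> \<longleftrightarrow> q ^ n = 1"
      using roots_nz by (auto simp: power_mult_distrib power_inverse field_simps)
    finally show ?thesis using xy by simp
  qed
  then show ?thesis by (simp add: lucas_rank_eq)
qed

lemma card_QQ: "card QQ = lucas_rank P Q (nat p)"
proof -
  have "{1} <#>\<^bsub>unit_group F0\<^esub> QQ = QQ" by (auto simp: set_mult_def)
  moreover have "subgroup {1} (unit_group F0)" using B.U.triv_subgroup by simp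
  ultimately show ?thesis
    using B.U.card_subgroup_mult_generate[OF B.finite_units, of q "{1}"] q_in by (simp add: split_rank)
qed

lemma split_units: "unit_group F0 \<cong> integer_mod_group (nat p - 1)"
  using B.units_iso by (simp add: card_F0)

lemma split_rank_dvd: "lucas_rank P Q (nat p) dvd nat p - 1"
  using B.U.lagrange[OF subgroup_QQ] unfolding card_QQ B.order_units card_F0 by (metis dvd_triv_right)

lemma split_star_quotient: "unit_group F0 Mod QQ \<cong> integer_mod_group ((nat p - 1) div lucas_rank P Q (nat p))"
  using B.units_quotient_iso[OF subgroup_QQ] unfolding card_QQ card_F0 .

end

section \<open>A double root in the prime field\<close>

locale lucas_roots_double = lucas_roots_split P Q p ty r r
  for P Q p and ty :: "'p::prime_card itself" and r
begin

lemma add_group: "group (add_monoid base_field :: 'p mod_ring alg_closure monoid)"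
proof (rule groupI)
  fix x y :: "'p mod_ring alg_closure"
  assume "x \<in> carrier (add_monoid base_field)" "y \<in> carrier (add_monoid base_field)"
  then show "x \<otimes>\<^bsub>add_monoid base_field\<^esub> y \<in> carrier (add_monoid base_field)"
    using F0_add by (simp add: base_field_def F0_def)
next
  show "\<one>\<^bsub>add_monoid base_field\<^esub> \<in> carrier (add_monoid (base_field :: 'p mod_ring alg_closure ring))"
    using F0_of_int[of 0] by (simp add: base_field_def F0_def)
next
  fix x :: "'p mod_ring alg_closure" assume "x \<in> carrier (add_monoid base_field)"
  then show "\<exists>y\<in>carrier (add_monoid base_field). y \<otimes>\<^bsub>add_monoid base_field\<^esub> x = \<one>\<^bsub>add_monoid base_field\<^esub>"
    using F0_minus by (intro bexI[of _ "- x"]) (simp_all add: base_field_def F0_def)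
qed (simp_all add: base_field_def add.assoc)

text \<open>The map is the logarithmic derivative of \<open>w1 - w0 * t\<close> at
  \<open>t = r\<close>, which is well defined modulo the square of \<open>t - r\<close>; so it turns
  products into sums. The computation uses \<open>P = r + r\<close>.\<close>

lemma additive_hom: "lucas_prime_hom TYPE('p) P Q p (add_monoid base_field)
    (\<lambda>w1 w0. - of_int w0 * inverse (of_int w1 - of_int w0 * r))"
proof -
  interpret B: group "add_monoid base_field :: 'p mod_ring alg_closure monoid" by (rule add_group)
  have sel: "carrier (add_monoid base_field) = F0" "\<one>\<^bsub>add_monoid base_field\<^esub> = (0 :: 'p mod_ring alg_closure)"
    "\<And>x y. x \<otimes>\<^bsub>add_monoid base_field\<^esub> y = x + (y :: 'p mod_ring alg_closure)"
    by (simp_all add: base_field_def F0_def)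
  show ?thesis
  proof (unfold_locales, unfold sel)
    fix a b
    show "- of_int b * inverse (of_int a - of_int b * r) \<in> F0"
      by (intro F0_closed linear_in_F0)
  next
    fix a b c d assume N: "\<not> p dvd N a b" "\<not> p dvd N c d"
    have nz: "of_int a - of_int b * r \<noteq> 0" "of_int c - of_int d * r \<noteq> 0" using N by (auto simp: N_unit_iff)
    have "of_int (b * c + a * d - P * b * d) =
        of_int b * (of_int c - of_int d * r) + of_int d * (of_int a - of_int b * r)"
      by (simp add: root_sum[symmetric] algebra_simps)
    moreover have "- (s * v + t * u) * (inverse u * inverse v) = - s * inverse u + - t * inverse v"
      if "u \<noteq> 0" "v \<noteq> 0" for s t u v :: "'p mod_ring alg_closure"
      using that by (simp add: field_simps)
    ultimately show "- of_int (b * c + a * d - P * b * d) *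
        inverse (of_int (a * c - Q * b * d) - of_int (b * c + a * d - P * b * d) * r) =
        - of_int b * inverse (of_int a - of_int b * r) + - of_int d * inverse (of_int c - of_int d * r)"
      unfolding linear_mult[OF disjI1[OF refl]] using nz
      by (simp only: inverse_mult_distrib)
  next
    fix y assume y: "y \<in> F0"
    \<comment> \<open>The pair is normalised to have the value \<open>a - b * r = 1\<close>, so that
      \<open>- b\<close> alone is the prescribed \<open>y\<close>.\<close>
    have "1 - y * r \<in> F0" using F0_diff[OF F0_of_int[of 1] F0_mult[OF y r1_in]] by simp
    then obtain a where a: "1 - y * r = of_int a" by (rule F0_obtain)
    obtain b where b: "- y = of_int b" using F0_minus[OF y] by (rule F0_obtain)
    have "of_int a - of_int b * r = 1" by (simp add: a[symmetric] b[symmetric])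
    then show "\<exists>a b. \<not> p dvd N a b \<and> - of_int b * inverse (of_int a - of_int b * r) = y"
      by (intro exI[of _ a] exI[of _ b]) (simp add: N_unit_iff b[symmetric])
  next
    fix a b assume "p dvd b"
    then have "of_int b = (0 :: 'p mod_ring alg_closure)" by (simp add: of_int_ac_eq_0_iff)
    then show "- of_int b * inverse (of_int a - of_int b * r) = 0" by simp
  qed
qed

lemma double_K_iso: "K_iso_via P Q ty (add_monoid base_field)
    (\<lambda>w1 w0. - of_int w0 * inverse (of_int w1 - of_int w0 * r))"
proof -
  interpret h: lucas_prime_hom P Q p ty "add_monoid base_field"
    "\<lambda>w1 w0. - of_int w0 * inverse (of_int w1 - of_int w0 * r)"
    by (rule additive_hom)
  show ?thesis
  proof (rule h.K_iso_viaI)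
    fix a b assume "\<not> p dvd N a b"
      "- of_int b * inverse (of_int a - of_int b * r) = \<one>\<^bsub>add_monoid base_field\<^esub>"
    then have "of_int b = (0 :: 'p mod_ring alg_closure)" by (simp add: N_unit_iff base_field_def)
    then show "p dvd b" by (simp add: of_int_ac_eq_0_iff)
  qed
qed

text \<open>The double root produces a term linear in \<open>k\<close>, as in the general solution
  of such a recurrence. The extra factor \<open>r\<close> avoids the exponent \<open>k - 1\<close>
  at \<open>k = 0\<close>.\<close>

lemma shiftp_pow_double:
  assumes "(shiftp ^^ k) (a, b) = (x, y)"
  shows "r * of_int y = r ^ k * (of_nat k * (of_int a - of_int b * r) + r * of_int b)"
  using assms
proof (induction k arbitrary: x y)
  case 0
  then show ?case by simp
next
  case (Suc k)
  obtain x' y' where xy: "(shiftp ^^ k) (a, b) = (x', y')" by fastforce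
  with Suc.prems have *: "y = x'" by (auto simp: shiftp_def)
  have "of_int x' = r ^ k * (of_int a - of_int b * r) + r * of_int y'"
    using shiftp_pow_linear(1)[OF xy] by (simp add: algebra_simps)
  also have "\<dots> = r ^ k * (of_int a - of_int b * r) + r ^ k * (of_nat k * (of_int a - of_int b * r) + r * of_int b)"
    unfolding Suc.IH[OF xy] ..
  finally have "r * of_int y = r * (r ^ k * (of_int a - of_int b * r) +
      r ^ k * (of_nat k * (of_int a - of_int b * r) + r * of_int b))" unfolding * by (rule arg_cong)
  then show ?case by (simp add: algebra_simps)
qed

text \<open>Under the additive map a shift is the translation by \<open>- 1 / r\<close>, whose
  multiples run through the whole prime field; so the orbit of any pair meets \<open>G(f,p)\<close>.
  The number of shifts is a natural number representing \<open>- r * b / v\<close>.\<close>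

lemma double_shift_in_H:
  assumes N: "\<not> p dvd N a b"
  shows "\<exists>k. p dvd snd ((shiftp ^^ k) (a, b))"
proof -
  define v where "v = of_int a - of_int b * r"
  have v: "v \<in> F0" "v \<noteq> 0" using N linear_in_F0 by (auto simp: v_def N_unit_iff)
  have "- (r * of_int b) * inverse v \<in> F0" by (intro F0_closed r1_in v)
  then obtain k :: nat where k: "- (r * of_int b) * inverse v = of_nat k" using F0_iff by blast
  have kv: "of_nat k * v + r * of_int b = 0" unfolding k[symmetric] using v by simp
  obtain x y where xy: "(shiftp ^^ k) (a, b) = (x, y)" by fastforce
  have "r * of_int y = 0" using shiftp_pow_double[OF xy] kv unfolding v_def by simp
  then have "p dvd y" using roots_nz by (simp add: of_int_ac_eq_0_iff)
  then show ?thesis using xy by (metis snd_conv)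
qed

lemma Kstar_eq_Gstar: "Kstar_sub P Q ty = Gstar_sub P Q ty"
proof
  show "Gstar_sub P Q ty \<subseteq> Kstar_sub P Q ty"
    unfolding Gstar_sub_def Kstar_sub_def using H_subset_K by (rule image_mono)
  show "Kstar_sub P Q ty \<subseteq> Gstar_sub P Q ty"
  proof
    fix A assume "A \<in> Kstar_sub P Q ty"
    then obtain B where B: "B \<in> KK" "A = to_star P Q B" unfolding Kstar_sub_def by blast
    obtain a b where ab: "\<not> p dvd N a b" "B = pcls a b" using B(1) by (rule K_rep)
    obtain k where "p dvd snd ((shiftp ^^ k) (a, b))" using double_shift_in_H[OF ab(1)] by blast
    then obtain x y where xy: "(shiftp ^^ k) (a, b) = (x, y)" "p dvd y" by (metis prod.collapse)
    with pstar_shiftp_pow[OF ab(1) xy(1)] have "\<not> p dvd N x y" "A = pstar x y" using B ab by simp_all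
    then show "A \<in> Gstar_sub P Q ty" unfolding Gstar_sub_def using pcls_in_H_iff xy(2) by blast
  qed
qed

lemma double_Kstar_trivial: "trivial_group (Kstar_grp P Q ty Mod Gstar_sub P Q ty)"
proof -
  interpret K: comm_group "Kstar_grp P Q ty" by (rule comm_group_Kstar)
  have car: "carrier (Kstar_grp P Q ty) = Gstar_sub P Q ty"
    by (simp add: Kstar_grp_def Kstar_eq_Gstar)
  have "group (Kstar_grp P Q ty Mod Gstar_sub P Q ty)"
    by (rule normal.factorgroup_is_group[OF K.subgroup_imp_normal[OF subgroup_Gstar_Kstar]])
  moreover have "carrier (Kstar_grp P Q ty Mod Gstar_sub P Q ty) = {\<one>\<^bsub>Kstar_grp P Q ty Mod Gstar_sub P Q ty\<^esub>}"
  proof -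
    have "Gstar_sub P Q ty #>\<^bsub>Kstar_grp P Q ty\<^esub> x = Gstar_sub P Q ty" if "x \<in> Gstar_sub P Q ty" for x
      using that K.coset_join2[OF _ subgroup_Gstar_Kstar] car by blast
    moreover have "Gstar_sub P Q ty \<noteq> {}" using subgroup.one_closed[OF subgroup_Gstar_Kstar] by blast
    ultimately show ?thesis unfolding carrier_FactGroup car one_FactGroup by (intro equalityI subsetI) auto
  qed
  ultimately show ?thesis unfolding trivial_group_def ..
qed

end

section \<open>Irreducibility of the quadratic and the union of the cases\<close>

lemma char_poly2_root_iff: "poly (char_poly2 P Q) x = 0 \<longleftrightarrow> x\<^sup>2 - of_int P * x + of_int Q = (0 :: 'a::field)"
  by (simp add: char_poly2_def power2_eq_square algebra_simps)

text \<open>In degree 2 a proper factorisation consists of linear factors, and a linear factor over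
  a field has a root.\<close>

lemma irreducible_char_poly2_iff:
  "Factorial_Ring.irreducible (char_poly2 P Q :: 'a::field poly) \<longleftrightarrow> (\<nexists>x :: 'a. poly (char_poly2 P Q) x = 0)"
proof -
  let ?f = "char_poly2 P Q :: 'a poly"
  have deg: "Polynomial.degree ?f = 2" by (simp add: char_poly2_def)
  then have f0: "?f \<noteq> 0" by auto
  have unit_iff: "g dvd 1 \<longleftrightarrow> Polynomial.degree g = 0" if "g \<noteq> 0" for g :: "'a poly"
    using that by (simp add: is_unit_iff_degree)
  show ?thesis
  proof (intro iffI notI)
    assume irr: "Factorial_Ring.irreducible ?f" and "\<exists>x. poly ?f x = 0"
    then obtain x g where g: "?f = [:- x, 1:] * g" by (metis poly_eq_0_iff_dvd dvdE)
    then have g0: "g \<noteq> 0" using f0 by auto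
    have "Polynomial.degree [:- x, 1:] + Polynomial.degree g = 2"
      using g g0 deg by (metis degree_mult_eq pCons_eq_0_iff one_neq_zero)
    then have "\<not> [:- x, 1:] dvd 1" "\<not> g dvd 1" using unit_iff[of "[:- x, 1:]"] unit_iff[OF g0] by simp_all
    then show False using irr g unfolding Factorial_Ring.irreducible_def by blast
  next
    assume no: "\<nexists>x. poly ?f x = 0"
    show "Factorial_Ring.irreducible ?f"
    proof (rule Factorial_Ring.irreducibleI)
      show "\<not> ?f dvd 1" using unit_iff[OF f0] deg by simp
      fix g h assume gh: "?f = g * h"
      then have nz: "g \<noteq> 0" "h \<noteq> 0" using f0 by auto
      have sum: "Polynomial.degree g + Polynomial.degree h = 2" using gh nz deg by (metis degree_mult_eq)
      have no_linear: "Polynomial.degree g' \<noteq> 1" if dvd: "g' dvd ?f" for g'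
      proof
        assume "Polynomial.degree g' = 1"
        then obtain c d where cd: "g' = [:c, d:]" "d \<noteq> 0"
          by (metis degree1_coeffs One_nat_def)
        then have "poly g' (- c / d) = 0" by simp
        then have "poly ?f (- c / d) = 0" using dvd by (auto elim!: dvdE)
        then show False using no by blast
      qed
      have "Polynomial.degree g \<noteq> 1" using no_linear[of g] gh by simp
      then have "Polynomial.degree g = 0 \<or> Polynomial.degree h = 0" using sum by linarith
      then show "g dvd 1 \<or> h dvd 1" using unit_iff nz by blast
    qed (rule f0)
  qed
qed

theorem theorem9:
  fixes P Q :: int and p :: nat and \<theta>\<^sub>1 \<theta>\<^sub>2 :: "'p::prime_card mod_ring alg_closure"
  assumes p: "p = CARD('p)"
    and "Q \<noteq> 0"
    and "P ^ 2 - 4 * Q \<noteq> 0"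
    and "\<not> int p dvd Q"
    and roots: "char_poly2 P Q = [:- \<theta>\<^sub>1, 1:] * [:- \<theta>\<^sub>2, 1:]"
  shows
    "subgroup (K_sub P Q TYPE('p)) (G_grp P Q) \<and>
     subgroup (G_sub P Q TYPE('p)) (K_grp P Q TYPE('p)) \<and>
     subgroup (Kstar_sub P Q TYPE('p)) (Gstar_grp P Q) \<and>
     subgroup (Gstar_sub P Q TYPE('p)) (Kstar_grp P Q TYPE('p)) \<and>
     (Factorial_Ring.irreducible (char_poly2 P Q :: 'p mod_ring poly) \<longrightarrow>
        (let U = mult_group (adjoin \<theta>\<^sub>1);
             F = carrier (mult_group base_field);
             N = F <#>\<^bsub>U\<^esub> generate U {\<theta>\<^sub>1}
         in
         K_iso_via P Q TYPE('p) (U Mod F)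
           (\<lambda>w1 w0. F #>\<^bsub>U\<^esub> (of_int w1 - of_int w0 * \<theta>\<^sub>1)) \<and>
         U Mod F \<cong> integer_mod_group (p + 1) \<and>
         Kstar_iso_via P Q TYPE('p) (U Mod N)
           (\<lambda>w1 w0. N #>\<^bsub>U\<^esub> (of_int w1 - of_int w0 * \<theta>\<^sub>1)) \<and>
         lucas_rank P Q p dvd p + 1 \<and>
         U Mod N \<cong> integer_mod_group ((p + 1) div lucas_rank P Q p))) \<and>
     (\<not> Factorial_Ring.irreducible (char_poly2 P Q :: 'p mod_ring poly) \<longrightarrow>
        (\<not> int p dvd P ^ 2 - 4 * Q \<longrightarrow>
          (let U = mult_group base_field;
               N = generate U {\<theta>\<^sub>1 * inverse \<theta>\<^sub>2}
           in
           K_iso_via P Q TYPE('p) U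
             (\<lambda>w1 w0. (of_int w1 - of_int w0 * \<theta>\<^sub>1) * inverse (of_int w1 - of_int w0 * \<theta>\<^sub>2)) \<and>
           U \<cong> integer_mod_group (p - 1) \<and>
           Kstar_iso_via P Q TYPE('p) (U Mod N)
             (\<lambda>w1 w0. N #>\<^bsub>U\<^esub>
               ((of_int w1 - of_int w0 * \<theta>\<^sub>1) * inverse (of_int w1 - of_int w0 * \<theta>\<^sub>2))) \<and>
           lucas_rank P Q p dvd p - 1 \<and>
           U Mod N \<cong> integer_mod_group ((p - 1) div lucas_rank P Q p))) \<and>
        (int p dvd P ^ 2 - 4 * Q \<longrightarrow>
          (\<forall>\<theta> :: 'p mod_ring alg_closure. Polynomial.order \<theta> (char_poly2 P Q) = 2 \<longrightarrow>
             K_iso_via P Q TYPE('p) (add_monoid base_field)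
               (\<lambda>w1 w0. - of_int w0 * inverse (of_int w1 - of_int w0 * \<theta>))) \<and>
          trivial_group (Kstar_grp P Q TYPE('p) Mod Gstar_sub P Q TYPE('p))))"
proof -
  have coeffs: "\<theta>\<^sub>1 + \<theta>\<^sub>2 = of_int P" "\<theta>\<^sub>1 * \<theta>\<^sub>2 = of_int Q"
  proof -
    have "[:of_int Q, - of_int P, 1:] = [:\<theta>\<^sub>1 * \<theta>\<^sub>2, - (\<theta>\<^sub>1 + \<theta>\<^sub>2), 1:]"
      using roots by (simp add: char_poly2_def)
    then have *: "of_int Q = \<theta>\<^sub>1 * \<theta>\<^sub>2" "- of_int P = - (\<theta>\<^sub>1 + \<theta>\<^sub>2)"
      unfolding pCons_eq_iff by blast+
    show "\<theta>\<^sub>1 * \<theta>\<^sub>2 = of_int Q" using *(1) by (rule sym)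
    show "\<theta>\<^sub>1 + \<theta>\<^sub>2 = of_int P" using *(2) unfolding neg_equal_iff_equal by (rule sym)
  qed
  interpret L: lucas_roots P Q "int p" "TYPE('p)" \<theta>\<^sub>1 \<theta>\<^sub>2
    by unfold_locales (use p assms(4) coeffs in simp_all)
  have np: "nat (int p) = p" by simp
  have poly_ac: "poly (char_poly2 P Q) z = (z - \<theta>\<^sub>1) * (z - \<theta>\<^sub>2)" for z :: "'p mod_ring alg_closure"
    unfolding roots by (simp add: algebra_simps)
  \<comment> \<open>The discriminant is the square of the difference of the roots, so
    \<open>p\<close> divides it exactly when they coincide.\<close>
  have disc: "of_int (P ^ 2 - 4 * Q) = (\<theta>\<^sub>1 - \<theta>\<^sub>2)\<^sup>2"
    by (simp add: coeffs[symmetric] power2_eq_square algebra_simps)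
  have r2_eq: "\<theta>\<^sub>2 = of_int P - \<theta>\<^sub>1" and r1_eq: "\<theta>\<^sub>1 = of_int P - \<theta>\<^sub>2"
    by (simp_all add: coeffs(1)[symmetric])
  \<comment> \<open>The sum of the roots lies in the prime field, so it contains both or
    neither.\<close>
  have F0_iff: "\<theta>\<^sub>1 \<in> L.F0 \<longleftrightarrow> \<theta>\<^sub>2 \<in> L.F0"
    using L.F0_diff[OF L.F0_of_int] r1_eq r2_eq by metis
  have irr_iff: "Factorial_Ring.irreducible (char_poly2 P Q :: 'p mod_ring poly) \<longleftrightarrow> \<theta>\<^sub>1 \<notin> L.F0"
  proof -
    have "poly (char_poly2 P Q) x = 0 \<longleftrightarrow> to_ac x = \<theta>\<^sub>1 \<or> to_ac x = \<theta>\<^sub>2" for x :: "'p mod_ring"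
    proof -
      have "poly (char_poly2 P Q) x = 0 \<longleftrightarrow> to_ac (x\<^sup>2 - of_int P * x + of_int Q) = 0"
        unfolding char_poly2_root_iff by (rule to_ac_eq_0_iff[symmetric])
      also have "\<dots> \<longleftrightarrow> poly (char_poly2 P Q) (to_ac x) = 0"
        unfolding char_poly2_root_iff by simp
      finally show ?thesis by (simp add: poly_ac)
    qed
    then show ?thesis
      unfolding irreducible_char_poly2_iff using F0_iff by (auto simp: L.F0_def)
  qed
  have base: "mult_group base_field = unit_group L.F0" by (rule L.base_field_units)
  have inert: "let U = mult_group (adjoin \<theta>\<^sub>1);
             F = carrier (mult_group base_field);
             N = F <#>\<^bsub>U\<^esub> generate U {\<theta>\<^sub>1}
         in
         K_iso_via P Q TYPE('p) (U Mod F)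
           (\<lambda>w1 w0. F #>\<^bsub>U\<^esub> (of_int w1 - of_int w0 * \<theta>\<^sub>1)) \<and>
         U Mod F \<cong> integer_mod_group (p + 1) \<and>
         Kstar_iso_via P Q TYPE('p) (U Mod N)
           (\<lambda>w1 w0. N #>\<^bsub>U\<^esub> (of_int w1 - of_int w0 * \<theta>\<^sub>1)) \<and>
         lucas_rank P Q p dvd p + 1 \<and>
         U Mod N \<cong> integer_mod_group ((p + 1) div lucas_rank P Q p)"
    if "\<theta>\<^sub>1 \<notin> L.F0"
  proof -
    interpret I: lucas_roots_inert P Q "int p" "TYPE('p)" \<theta>\<^sub>1 \<theta>\<^sub>2
      by unfold_locales (rule that)
    show ?thesis
      unfolding Let_def base I.adjoin_units unit_group_sel(1)
      by (intro conjI I.inert_K_iso I.inert_quotient[unfolded np] I.inert_Kstar_iso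
          I.inert_rank_dvd[unfolded np] I.inert_star_quotient[unfolded np])
  qed
  have split: "let U = mult_group base_field;
               N = generate U {\<theta>\<^sub>1 * inverse \<theta>\<^sub>2}
           in
           K_iso_via P Q TYPE('p) U
             (\<lambda>w1 w0. (of_int w1 - of_int w0 * \<theta>\<^sub>1) * inverse (of_int w1 - of_int w0 * \<theta>\<^sub>2)) \<and>
           U \<cong> integer_mod_group (p - 1) \<and>
           Kstar_iso_via P Q TYPE('p) (U Mod N)
             (\<lambda>w1 w0. N #>\<^bsub>U\<^esub>
               ((of_int w1 - of_int w0 * \<theta>\<^sub>1) * inverse (of_int w1 - of_int w0 * \<theta>\<^sub>2))) \<and>
           lucas_rank P Q p dvd p - 1 \<and>
           U Mod N \<cong> integer_mod_group ((p - 1) div lucas_rank P Q p)"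
    if "\<theta>\<^sub>1 \<in> L.F0" "\<not> int p dvd P ^ 2 - 4 * Q"
  proof -
    have "(\<theta>\<^sub>1 - \<theta>\<^sub>2)\<^sup>2 \<noteq> 0" unfolding disc[symmetric] L.of_int_ac_eq_0_iff by (rule that(2))
    then interpret S: lucas_roots_distinct P Q "int p" "TYPE('p)" \<theta>\<^sub>1 \<theta>\<^sub>2
      by unfold_locales (use that(1) F0_iff in auto)
    show ?thesis
      unfolding Let_def base
      by (intro conjI S.split_K_iso S.split_units[unfolded np] S.split_Kstar_iso
          S.split_rank_dvd[unfolded np] S.split_star_quotient[unfolded np])
  qed
  have double: "\<forall>\<theta> :: 'p mod_ring alg_closure. Polynomial.order \<theta> (char_poly2 P Q) = 2 \<longrightarrow>
             K_iso_via P Q TYPE('p) (add_monoid base_field)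
               (\<lambda>w1 w0. - of_int w0 * inverse (of_int w1 - of_int w0 * \<theta>))"
          "trivial_group (Kstar_grp P Q TYPE('p) Mod Gstar_sub P Q TYPE('p))"
    if "\<theta>\<^sub>1 \<in> L.F0" "int p dvd P ^ 2 - 4 * Q"
  proof -
    have "(\<theta>\<^sub>1 - \<theta>\<^sub>2)\<^sup>2 = 0" unfolding disc[symmetric] L.of_int_ac_eq_0_iff by (rule that(2))
    then have eq: "\<theta>\<^sub>2 = \<theta>\<^sub>1" by simp
    interpret D: lucas_roots_double P Q "int p" "TYPE('p)" \<theta>\<^sub>1
      by unfold_locales (use that(1) coeffs eq in simp_all)
    \<comment> \<open>Positive multiplicity makes \<open>\<theta>\<close> a root, and the only root
      left is the double one.\<close>
    have "\<theta> = \<theta>\<^sub>1" if "Polynomial.order \<theta> (char_poly2 P Q) = 2" for \<theta> :: "'p mod_ring alg_closure"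
    proof -
      have "poly (char_poly2 P Q) \<theta> = 0" using that order_root[of _ \<theta>] by auto
      then show ?thesis by (simp add: poly_ac eq)
    qed
    then show "\<forall>\<theta> :: 'p mod_ring alg_closure. Polynomial.order \<theta> (char_poly2 P Q) = 2 \<longrightarrow>
        K_iso_via P Q TYPE('p) (add_monoid base_field)
          (\<lambda>w1 w0. - of_int w0 * inverse (of_int w1 - of_int w0 * \<theta>))"
      using D.double_K_iso by blast
    show "trivial_group (Kstar_grp P Q TYPE('p) Mod Gstar_sub P Q TYPE('p))"
      by (rule D.double_Kstar_trivial)
  qed
  show ?thesis
    unfolding irr_iff not_not
    by (intro conjI impI L.subgroup_K L.subgroup_H_K L.subgroup_Kstar L.subgroup_Gstar_Kstar
        inert split double)
qed

end
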